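(* Consider long-range first-passage percolation on $\mathbb{Z}^d$ (setting in the context) with a nonnegative non-increasing rate function $r(k)=k^{-\alpha}L(k)$, $k\ge1$, where $\alpha\in(2d,2d+1)$ and $L$ is slowly varying at infinity with $L(1)=1$. Let $\Gamma(\alpha,d)=\alpha-2d$. Then for every $\varepsilon>0$: (1) $\displaystyle\lim_{\|x\|_1\to\infty}\mathbb{P}\Big(\Gamma(\alpha,d)-\varepsilon\le\frac{\log T(0,x)}{\log\|x\|_1}\le\Gamma(\alpha,d)+\varepsilon\Big)=1$; (2) $\displaystyle\lim_{t\to\infty}\mathbb{P}\Big(\Big|\frac{\log D_t}{\log t}-\frac1{\Gamma(\alpha,d)}\Big|\le\varepsilon\Big)=1$.
   Context: Let $d\ge1$ and $\|x\|_1=\sum_i|x_i|$. Let $\mathcal{E}$ be the set of unordered pairs $e=\langle xy\rangle$ of distinct points of $\mathbb{Z}^d$, with length $\|e\|_1=\|x-y\|_1$. Let $(\omega_e)$ be i.i.d. mean-one exponential random variables and $W_e=\omega_e/r(\|e\|_1)$. For a finite path $\pi=\langle x_0\dots x_k\rangle$ ($x_i\ne x_{i-1}$), $W_\pi=\sum_iW_{\langle x_{i-1}x_i\rangle}$; $T(x,y)$ is the infimum of $W_\pi$ over finite paths from $x$ to $y$; $\mathcal{B}_t=\{x:T(0,x)\le t\}$ and $D_t=\sup\{\|x-y\|_1:x,y\in\mathcal{B}_t\}$. *)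

theory Defs
  imports "HOL-Probability.Probability"
begin

definition l1 :: "int ^ 'd::finite \<Rightarrow> nat" where
  "l1 x = nat (\<Sum>i\<in>UNIV. \<bar>x $ i\<bar>)"

definition lr_edges :: "(int ^ 'd::finite) set set" where
  "lr_edges = {{x, y} | x y. x \<noteq> y}"

definition slowly_varying :: "(real \<Rightarrow> real) \<Rightarrow> bool" where
  "slowly_varying L \<longleftrightarrow> L \<in> borel_measurable borel \<and> (\<forall>x\<ge>1. 0 < L x) \<and>
     (\<forall>c>0. ((\<lambda>x. L (c * x) / L x) \<longlongrightarrow> 1) at_top)"

definition lr_path :: "(int ^ 'd::finite) list \<Rightarrow> bool" where
  "lr_path p \<longleftrightarrow> p \<noteq> [] \<and> (\<forall>i. Suc i < length p \<longrightarrow> p ! i \<noteq> p ! Suc i)"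

definition lr_W :: "(nat \<Rightarrow> real) \<Rightarrow> ((int ^ 'd::finite) set \<Rightarrow> real) \<Rightarrow> int ^ 'd \<Rightarrow> int ^ 'd \<Rightarrow> real" where
  "lr_W r w x y = w {x, y} / r (l1 (x - y))"

definition path_weight :: "(nat \<Rightarrow> real) \<Rightarrow> ((int ^ 'd::finite) set \<Rightarrow> real) \<Rightarrow> (int ^ 'd) list \<Rightarrow> real" where
  "path_weight r w p = (\<Sum>i<length p - 1. lr_W r w (p ! i) (p ! Suc i))"

definition passage_time :: "(nat \<Rightarrow> real) \<Rightarrow> ((int ^ 'd::finite) set \<Rightarrow> real) \<Rightarrow> int ^ 'd \<Rightarrow> int ^ 'd \<Rightarrow> ereal" where
  "passage_time r w x y =
     (INF p\<in>{p. lr_path p \<and> hd p = x \<and> last p = y}. ereal (path_weight r w p))"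

definition ball_T :: "(nat \<Rightarrow> real) \<Rightarrow> ((int ^ 'd::finite) set \<Rightarrow> real) \<Rightarrow> real \<Rightarrow> (int ^ 'd) set" where
  "ball_T r w t = {x. passage_time r w 0 x \<le> ereal t}"

definition diam_T :: "(nat \<Rightarrow> real) \<Rightarrow> ((int ^ 'd::finite) set \<Rightarrow> real) \<Rightarrow> real \<Rightarrow> ereal" where
  "diam_T r w t = (SUP (x, y)\<in>ball_T r w t \<times> ball_T r w t. ereal (real (l1 (x - y))))"

end

(*
Lower bound. A path of weight t leaving a ball of radius n either uses an edge longer than
m = n^(1 - delta) inside the ball, which is unlikely for t = n^beta with beta < alpha - 2d and small
delta, or it visits about n / m well separated blocks of side m. In the second case at least half of
these blocks are left in time t m / n up to a constant. Crossing events of separated blocks are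
independent, so a Peierls count makes this unlikely as soon as a single fast crossing at scale m has
small probability. The time exponent is thereby improved from beta' to
delta + (1 - delta) beta' > beta', because alpha - 2d < 1; starting from a very negative exponent,
where a single cheap edge would be needed, finitely many steps reach every beta < alpha - 2d.

Upper bound. With high probability any two points at distance m <= 4n have neighbourhoods of radius
m / q joined by an edge of weight at most n^(alpha - 2d + epsilon), since there are of order m^(2d)
candidates of rate about m^(-alpha). Bridging the gaps recursively costs n^epsilon such edges.
*)

theory Submission
  imports Defs "HOL-Real_Asymp.Real_Asymp"
begin

section \<open>The lattice\<close>

text \<open>The threshold alpha - 2d comes from a first moment: a ball of radius n has order n^d
  sites, and the edges of length at least m at one site have total rate about m^(d - alpha), so at m
  = n an edge of weight at most n^beta is unlikely for beta < alpha - 2d. It remains to exclude many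
  short cheap edges. The obstacle is dependence, since pieces of one path can reuse the same region.
  Speed is therefore measured by crossings confined to a ball of radius 3m, and blocks are kept more
  than 6m apart so that their crossings share no edge. If one block is fast with probability at most
  theta^2, a given configuration with half of its K blocks fast has probability at most theta^K,
  while the number of configurations is exponential in K up to the choice of a start. A small
  constant theta suffices, so no decay rate has to be carried from scale to scale. The rate function
  enters through the limit of r(2k) / r(k): with monotonicity it yields power bounds with exponents
  arbitrarily close to alpha, and the strict inequalities between exponents absorb all
  constants.\<close>

lemma int_l1: "int (l1 x) = (\<Sum>i\<in>UNIV. \<bar>x $ i\<bar>)"
  by (simp add: l1_def sum_nonneg)

lemma l1_triangle: "l1 (x + y) \<le> l1 x + l1 y"
proof -
  have "int (l1 (x + y)) \<le> int (l1 x) + int (l1 y)"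
    unfolding int_l1 sum.distrib[symmetric] by (intro sum_mono) (simp add: abs_triangle_ineq)
  then show ?thesis by linarith
qed

lemma l1_triangle_diff: "l1 (x - z) \<le> l1 (x - y) + l1 (y - z)"
  using l1_triangle[of "x - y" "y - z"] by simp

lemma l1_minus_commute: "l1 (x - y) = l1 (y - x)"
  unfolding l1_def by (simp add: abs_minus_commute)

lemma l1_eq_0_iff [simp]: "l1 x = 0 \<longleftrightarrow> x = 0"
proof -
  have "l1 x = 0 \<longleftrightarrow> int (l1 x) = 0" by simp
  also have "\<dots> \<longleftrightarrow> x = 0"
    unfolding int_l1 by (simp add: sum_nonneg_eq_0_iff vec_eq_iff)
  finally show ?thesis .
qed

lemma l1_0 [simp]: "l1 0 = 0"
  by simp

lemma l1_pos_iff [simp]: "0 < l1 x \<longleftrightarrow> x \<noteq> 0"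
  by (simp flip: neq0_conv)

lemma l1_scale: "l1 (\<chi> i. int h * z $ i) = h * l1 z"
proof -
  have "int (l1 (\<chi> i. int h * z $ i)) = int (h * l1 z)"
    by (simp add: int_l1 abs_mult sum_distrib_left)
  then show ?thesis by linarith
qed

text \<open>Supplies the target vertex at a prescribed distance in the lower bound for the
  diameter.\<close>

lemma ex_l1_eq: "\<exists>x :: int ^ 'd::finite. l1 x = n"
proof
  show "l1 ((\<chi> i. if i = undefined then int n else 0) :: int ^ 'd) = n"
    by (simp add: l1_def if_distrib sum.If_cases)
qed

lemma card_vec_box:
  fixes A :: "'d::finite \<Rightarrow> 'b set"
  shows "card {x. \<forall>i. x $ i \<in> A i} = (\<Prod>i\<in>UNIV. card (A i))"
proof -
  have "bij_betw vec_nth {x. \<forall>i. x $ i \<in> A i} (PiE UNIV A)"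
    by (rule bij_betwI[where g = vec_lambda]) auto
  then have "card {x. \<forall>i. x $ i \<in> A i} = card (PiE UNIV A)"
    by (rule bij_betw_same_card)
  then show ?thesis by (simp add: card_PiE)
qed

lemma finite_vec_box:
  fixes A :: "'d::finite \<Rightarrow> 'b set"
  assumes "\<And>i. finite (A i)"
  shows "finite {x. \<forall>i. x $ i \<in> A i}"
proof -
  have "bij_betw vec_nth {x. \<forall>i. x $ i \<in> A i} (PiE UNIV A)"
    by (rule bij_betwI[where g = vec_lambda]) auto
  moreover have "finite (PiE UNIV A)" using assms by (intro finite_PiE) auto
  ultimately show ?thesis using bij_betw_finite by blast
qed

section \<open>Balls in the l1 norm and their cardinality\<close>

definition l1_ball :: "int ^ 'd::finite \<Rightarrow> nat \<Rightarrow> (int ^ 'd) set" where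
  "l1_ball c n = {x. l1 (x - c) \<le> n}"

lemma mem_l1_ball: "x \<in> l1_ball c n \<longleftrightarrow> l1 (x - c) \<le> n"
  by (simp add: l1_ball_def)

lemma abs_nth_le_l1: "\<bar>x $ i\<bar> \<le> int (l1 x)"
  unfolding int_l1 by (rule member_le_sum) auto

lemma l1_ball_subset_box: "l1_ball c n \<subseteq> {x. \<forall>i. x $ i \<in> {c $ i - int n..c $ i + int n}}"
proof (clarsimp simp: mem_l1_ball)
  fix x i assume "l1 (x - c) \<le> n"
  then show "c $ i - int n \<le> x $ i \<and> x $ i \<le> c $ i + int n"
    using abs_nth_le_l1[of "x - c" i] unfolding vector_minus_component by linarith
qed

lemma finite_l1_ball [simp]: "finite (l1_ball c n)"
  by (rule finite_subset[OF l1_ball_subset_box finite_vec_box]) simp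

lemma card_l1_ball_le:
  fixes c :: "int ^ 'd::finite"
  shows "card (l1_ball c n) \<le> (2 * n + 1) ^ CARD('d)"
proof -
  have "card (l1_ball c n) \<le> card {x. \<forall>i. x $ i \<in> {c $ i - int n..c $ i + int n}}"
    by (rule card_mono[OF finite_vec_box l1_ball_subset_box]) simp
  also have "\<dots> = (\<Prod>i\<in>(UNIV :: 'd set). 2 * n + 1)"
    unfolding card_vec_box by (rule prod.cong) (auto simp: nat_add_distrib)
  finally show ?thesis by simp
qed

text \<open>The cube of half-side \<open>n div CARD('d)\<close> fits into the ball, because
  \<open>CARD('d)\<close> coordinates of that size add up to at most \<open>n\<close>. Needed to
  have enough candidate bridges between two balls.\<close>

lemma card_l1_ball_ge:
  fixes c :: "int ^ 'd::finite"
  shows "(2 * (n div CARD('d)) + 1) ^ CARD('d) \<le> card (l1_ball c n)"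
proof -
  define k where "k = n div CARD('d)"
  have "(2 * k + 1) ^ CARD('d) = (\<Prod>i\<in>(UNIV :: 'd set). 2 * k + 1)" by simp
  also have "\<dots> = card {x. \<forall>i. x $ i \<in> {c $ i - int k..c $ i + int k}}"
    unfolding card_vec_box by (rule prod.cong) (auto simp: nat_add_distrib)
  also have "\<dots> \<le> card (l1_ball c n)"
  proof (rule card_mono)
    show "{x. \<forall>i. x $ i \<in> {c $ i - int k..c $ i + int k}} \<subseteq> l1_ball c n"
    proof (rule subsetI)
      fix x assume "x \<in> {x. \<forall>i. x $ i \<in> {c $ i - int k..c $ i + int k}}"
      then have x: "\<bar>(x - c) $ i\<bar> \<le> int k" for i by (auto simp: abs_le_iff) (smt (verit))+
      have "int (l1 (x - c)) \<le> (\<Sum>i\<in>(UNIV :: 'd set). int k)"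
        unfolding int_l1 by (intro sum_mono x)
      also have "\<dots> = int (CARD('d) * k)" by simp
      also have "\<dots> \<le> int n" unfolding k_def by (metis of_nat_le_iff times_div_less_eq_dividend)
      finally show "x \<in> l1_ball c n" by (simp add: mem_l1_ball)
    qed
  qed simp
  finally show ?thesis unfolding k_def .
qed

text \<open>The lower corner of the cube of side \<open>h\<close> containing \<open>x\<close>. It is
  kept as a lattice point rather than a grid index, so that distances between blocks and path
  vertices compare directly.\<close>

definition block :: "nat \<Rightarrow> int ^ 'd::finite \<Rightarrow> int ^ 'd" where
  "block h x = (\<chi> i. int h * (x $ i div int h))"

lemma l1_block:
  fixes x :: "int ^ 'd::finite"
  assumes "h > 0"
  shows "l1 (x - block h x) \<le> CARD('d) * h"
proof -
  have "int (l1 (x - block h x)) \<le> (\<Sum>i\<in>(UNIV :: 'd set). int h)"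
    unfolding int_l1
  proof (rule sum_mono)
    fix i
    have "(x - block h x) $ i = x $ i mod int h"
      by (simp add: block_def minus_mult_div_eq_mod)
    then show "\<bar>(x - block h x) $ i\<bar> \<le> int h" using assms by (simp add: less_imp_le)
  qed
  also have "\<dots> = int (CARD('d) * h)" by simp
  finally show ?thesis by linarith
qed

text \<open>Displacements between block corners at distance at most \<open>h * n\<close>. Their
  number has a bound free of \<open>h\<close>, so the entropy per block is the same constant at
  every scale.\<close>

definition block_steps :: "nat \<Rightarrow> nat \<Rightarrow> (int ^ 'd::finite) set" where
  "block_steps h n = (\<lambda>z. \<chi> i. int h * z $ i) ` l1_ball 0 n"

lemma finite_block_steps [simp]: "finite (block_steps h n)"
  by (simp add: block_steps_def)

lemma card_block_steps_le: "card (block_steps h n :: (int ^ 'd::finite) set) \<le> (2 * n + 1) ^ CARD('d)"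
  unfolding block_steps_def by (rule order_trans[OF card_image_le[OF finite_l1_ball] card_l1_ball_le])

lemma block_diff_mem_steps:
  fixes x y :: "int ^ 'd::finite"
  assumes "h > 0" "l1 (block h x - block h y) \<le> h * n"
  shows "block h x - block h y \<in> block_steps h n"
proof -
  define z :: "int ^ 'd" where "z = (\<chi> i. x $ i div int h - y $ i div int h)"
  have e: "block h x - block h y = (\<chi> i. int h * z $ i)"
    by (simp add: vec_eq_iff block_def z_def right_diff_distrib)
  have "h * l1 z \<le> h * n" using assms unfolding e l1_scale by simp
  then have "z \<in> l1_ball 0 n" using assms by (simp add: mem_l1_ball)
  then show ?thesis unfolding e block_steps_def by blast
qed

section \<open>Paths\<close>

lemma lr_path_Cons2: "lr_path (x # y # p) \<longleftrightarrow> x \<noteq> y \<and> lr_path (y # p)"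
proof
  assume *: "lr_path (x # y # p)"
  have "x \<noteq> y" using * unfolding lr_path_def by (auto dest: spec[of _ 0])
  moreover have "(y # p) ! i \<noteq> (y # p) ! Suc i" if "Suc i < length (y # p)" for i
    using * that unfolding lr_path_def by (auto dest: spec[of _ "Suc i"])
  ultimately show "x \<noteq> y \<and> lr_path (y # p)" unfolding lr_path_def by auto
next
  assume *: "x \<noteq> y \<and> lr_path (y # p)"
  have "(x # y # p) ! i \<noteq> (x # y # p) ! Suc i" if "Suc i < length (x # y # p)" for i
    using * that unfolding lr_path_def by (cases i) auto
  then show "lr_path (x # y # p)" unfolding lr_path_def by auto
qed

lemma lr_path_singleton [simp]: "lr_path [x]"
  by (simp add: lr_path_def)

lemma path_weight_singleton [simp]: "path_weight r w [x] = 0"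
  by (simp add: path_weight_def)

lemma path_weight_Cons2:
  "path_weight r w (x # y # p) = lr_W r w x y + path_weight r w (y # p)"
  by (simp add: path_weight_def sum.lessThan_Suc_shift del: sum.lessThan_Suc)

lemma lr_path_append:
  assumes "lr_path p" "lr_path (last p # q)"
  shows "lr_path (p @ q) \<and> path_weight r w (p @ q) = path_weight r w p + path_weight r w (last p # q)"
  using assms
proof (induction p rule: induct_list012)
  case 1 then show ?case by (simp add: lr_path_def)
next
  case (2 x) then show ?case by simp
next
  case (3 x y p) then show ?case by (simp add: lr_path_Cons2 path_weight_Cons2)
qed

lemma ex_path_trans:
  assumes "lr_path p" "hd p = x" "last p = y" "lr_path q" "hd q = y" "last q = z"
  shows "\<exists>p'. lr_path p' \<and> hd p' = x \<and> last p' = z \<and>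
    path_weight r w p' = path_weight r w p + path_weight r w q"
proof -
  have q: "q = last p # tl q" using assms by (cases q) (auto simp: lr_path_def)
  have "p \<noteq> []" using assms by (simp add: lr_path_def)
  have "lr_path (p @ tl q) \<and> path_weight r w (p @ tl q) = path_weight r w p + path_weight r w q"
    using lr_path_append[of p "tl q"] assms q by metis
  moreover have "last (p @ tl q) = z"
    using assms q by (metis append_Nil2 last_ConsL last_ConsR last_appendR)
  moreover have "hd (p @ tl q) = x" using assms \<open>p \<noteq> []\<close> by simp
  ultimately show ?thesis by blast
qed

lemma path_weight_map_upt:
  assumes "a \<le> b"
  shows "path_weight r w (map x [a..<Suc b]) = (\<Sum>i\<in>{a..<b}. lr_W r w (x i) (x (Suc i)))"
proof -
  have "path_weight r w (map x [a..<Suc b]) = (\<Sum>i<b - a. lr_W r w (x (a + i)) (x (Suc (a + i))))"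
    unfolding path_weight_def using assms
    by (intro sum.cong) (auto simp del: upt_Suc simp: nth_append)
  also have "\<dots> = (\<Sum>i\<in>{a..<b}. lr_W r w (x i) (x (Suc i)))"
    using assms by (intro sum.reindex_bij_witness[of _ "\<lambda>i. i - a" "\<lambda>i. a + i"]) auto
  finally show ?thesis .
qed

text \<open>Only the last vertex leaves the ball of radius \<open>2 * m\<close>. For
  \<open>l = m\<close> the whole path thus stays within \<open>3 * m\<close> of \<open>c\<close>,
  which makes a fast crossing a local event.\<close>

definition crossings :: "int ^ 'd::finite \<Rightarrow> nat \<Rightarrow> nat \<Rightarrow> (int ^ 'd) list set" where
  "crossings c m l = {p. lr_path p \<and> hd p \<in> l1_ball c m \<and> last p \<notin> l1_ball c (2 * m) \<and>
     (\<forall>i. Suc i < length p \<longrightarrow> p ! i \<in> l1_ball c (2 * m) \<and> l1 (p ! i - p ! Suc i) \<le> l)}"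

lemma first_crossing:
  fixes x :: "nat \<Rightarrow> int ^ 'd::finite"
  assumes "a \<le> b" "x a \<in> l1_ball c m" "x b \<notin> l1_ball c (2 * m)"
    and step: "\<And>i. a \<le> i \<Longrightarrow> i < b \<Longrightarrow> x i \<noteq> x (Suc i) \<and> l1 (x i - x (Suc i)) \<le> l"
  shows "\<exists>e. a \<le> e \<and> e \<le> b \<and> map x [a..<Suc e] \<in> crossings c m l"
proof -
  define e where "e = (LEAST e. a \<le> e \<and> x e \<notin> l1_ball c (2 * m))"
  have e: "a \<le> e \<and> x e \<notin> l1_ball c (2 * m)"
    unfolding e_def by (rule LeastI[where k = b]) (use assms in auto)
  have "e \<le> b" unfolding e_def by (rule Least_le) (use assms in auto)
  have less: "x i \<in> l1_ball c (2 * m)" if "a \<le> i" "i < e" for i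
    using not_less_Least[of i "\<lambda>e. a \<le> e \<and> x e \<notin> l1_ball c (2 * m)"] that
    unfolding e_def by auto
  have "map x [a..<Suc e] \<in> crossings c m l"
    unfolding crossings_def lr_path_def
    using e \<open>e \<le> b\<close> assms less
    by (auto simp: hd_map last_map hd_upt simp del: upt_Suc)
  then show ?thesis using e \<open>e \<le> b\<close> by blast
qed

text \<open>Loop erasure on the level of blocks: \<open>T (Suc j)\<close> is the time right after the last visit to the
  neighbourhood of block \<open>j\<close>. The blocks met at these times are pairwise far apart, although the path
  may return to any region many times, and consecutive ones are close.\<close>

lemma ex_separated_times:
  fixes x :: "nat \<Rightarrow> int ^ 'd::finite"
  assumes h: "h > 0" and m: "m = CARD('d) * h"
    and step: "\<And>i. i < N \<Longrightarrow> l1 (x i - x (Suc i)) \<le> m"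
    and far: "(9 * K + 8) * m < l1 (x N - x 0)"
  shows "\<exists>T. T 0 = 0 \<and> (\<forall>j\<le>K. T j \<le> N) \<and> (\<forall>j<K. T j < T (Suc j)) \<and>
    (\<forall>j<K. \<forall>i. T (Suc j) \<le> i \<longrightarrow> i \<le> N \<longrightarrow> 7 * m < l1 (x i - block h (x (T j)))) \<and>
    (\<forall>j<K. l1 (block h (x (T (Suc j))) - block h (x (T j))) \<le> 9 * m)"
proof -
  \<comment> \<open>Why \<open>7 * m\<close>: rounding a later vertex to its block costs at most
    \<open>m\<close>, which leaves blocks more than \<open>6 * m\<close> apart. The jump after the
    last visit ends within \<open>8 * m\<close>, and the block reached within
    \<open>9 * m\<close>.\<close>
  define A where "A t = {i. i \<le> N \<and> l1 (x i - block h (x t)) \<le> 7 * m}" for t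
  define T where "T j = ((\<lambda>t. Suc (Max (A t))) ^^ j) 0" for j
  have T0: "T 0 = 0" by (simp add: T_def)
  have TS: "T (Suc j) = Suc (Max (A (T j)))" for j by (simp add: T_def)
  have fin: "finite (A t)" for t unfolding A_def by simp
  have bl: "l1 (y - block h y) \<le> m" for y :: "int ^ 'd" unfolding m by (rule l1_block[OF h])
  have in_A: "t \<in> A t" if "t \<le> N" for t
    using that bl[of "x t"] unfolding A_def by auto
  have step_ok: "T j < T (Suc j) \<and> (\<forall>i. T (Suc j) \<le> i \<longrightarrow> i \<le> N \<longrightarrow> 7 * m < l1 (x i - block h (x (T j)))) \<and>
      T (Suc j) \<le> N \<and> l1 (block h (x (T (Suc j))) - block h (x (T j))) \<le> 9 * m"
    if j: "T j \<le> N" "l1 (block h (x (T j)) - block h (x 0)) \<le> 9 * m * j" "j < K" for j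
  proof -
    let ?b = "block h (x (T j))" and ?M = "Max (A (T j))"
    have M: "?M \<in> A (T j)" using fin in_A[OF j(1)] by (intro Max_in) auto
    have "T j \<le> ?M" using fin in_A[OF j(1)] by (intro Max_ge) auto
    \<comment> \<open>At most \<open>9 * m * j\<close> has been travelled between blocks, plus
      \<open>m\<close> for rounding \<open>x 0\<close>. The distance \<open>(9 * K + 8) * m\<close>
      therefore leaves more than \<open>7 * m\<close> to the endpoint, and the last visit happens
      before time \<open>N\<close>.\<close>
    have "9 * m * j \<le> 9 * m * K" using j(3) by simp
    moreover have K: "(9 * K + 8) * m = 9 * m * K + 8 * m" by (simp add: algebra_simps)
    ultimately have "7 * m < l1 (x N - ?b)"
      using far j(2) bl[of "x 0"] l1_triangle_diff[of "x N" "x 0" ?b]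
        l1_triangle_diff[of ?b "x 0" "block h (x 0)"] l1_minus_commute[of "x 0" "block h (x 0)"]
        K by linarith
    then have "N \<notin> A (T j)" unfolding A_def by simp
    then have "?M \<noteq> N" using M by metis
    moreover have "?M \<le> N" using M unfolding A_def by blast
    ultimately have "?M < N" by simp
    have out: "7 * m < l1 (x i - ?b)" if "T (Suc j) \<le> i" "i \<le> N" for i
    proof (rule ccontr)
      assume "\<not> 7 * m < l1 (x i - ?b)"
      then have "i \<in> A (T j)" using that unfolding A_def by simp
      then have "i \<le> ?M" using fin by (intro Max_ge) auto
      then show False using that unfolding TS by simp
    qed
    have "l1 (x (Suc ?M) - ?b) \<le> 8 * m"
      using M step[OF \<open>?M < N\<close>] l1_triangle_diff[of "x (Suc ?M)" ?b "x ?M"]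
        l1_minus_commute[of "x ?M" "x (Suc ?M)"] unfolding A_def by simp
    then have "l1 (block h (x (Suc ?M)) - ?b) \<le> 9 * m"
      using bl[of "x (Suc ?M)"] l1_triangle_diff[of "block h (x (Suc ?M))" ?b "x (Suc ?M)"]
        l1_minus_commute[of "x (Suc ?M)" "block h (x (Suc ?M))"] by simp
    then show ?thesis using out \<open>?M < N\<close> \<open>T j \<le> ?M\<close> unfolding TS by simp
  qed
  have inv: "T j \<le> N \<and> l1 (block h (x (T j)) - block h (x 0)) \<le> 9 * m * j" if "j \<le> K" for j
    using that
  proof (induction j)
    case 0 then show ?case by (simp add: T0)
  next
    case (Suc j)
    then have IH: "T j \<le> N" "l1 (block h (x (T j)) - block h (x 0)) \<le> 9 * m * j" "j < K" by auto
    show ?case using step_ok[OF IH] IH(2)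
        l1_triangle_diff[of "block h (x (T (Suc j)))" "block h (x 0)" "block h (x (T j))"] by simp
  qed
  show ?thesis
    using inv step_ok T0 by (intro exI[of _ T]) (meson less_imp_le)
qed

text \<open>Codes a sequence of blocks by a start and increments from a fixed finite set, which is
  the form in which sequences are counted.\<close>

definition chain :: "int ^ 'd::finite \<Rightarrow> (nat \<Rightarrow> int ^ 'd) \<Rightarrow> nat \<Rightarrow> int ^ 'd" where
  "chain a v j = a + (\<Sum>i<j. v i)"

text \<open>Between consecutive separated times the path starts within \<open>m\<close> of its block
  and ends more than \<open>7 * m\<close> away, so that piece contains a crossing of the block. If
  fewer than half of the blocks had a crossing of weight at most \<open>\<tau>\<close>, the other
  pieces alone would weigh more than \<open>K * \<tau> / 2\<close>, hence more than
  \<open>t\<close>.\<close>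

lemma crossing_imp_fast_blocks:
  fixes w :: "(int ^ 'd::finite) set \<Rightarrow> real"
  assumes h: "h > 0" and m: "m = CARD('d) * h"
    and nonneg: "\<And>x y. x \<noteq> y \<Longrightarrow> 0 \<le> lr_W r w x y"
    and p: "p \<in> crossings c n m" and n: "(9 * K + 8) * m \<le> n"
    and t: "path_weight r w p \<le> t" "2 * t \<le> real K * \<tau>" and \<tau>: "0 < \<tau>" and K: "0 < K"
  shows "\<exists>a\<in>block h ` l1_ball c n. \<exists>v\<in>PiE {..<K} (\<lambda>_. block_steps h (9 * CARD('d))).
    \<exists>J\<in>Pow {..<K}. K \<le> 2 * card J \<and>
      (\<forall>i\<in>J. \<forall>j\<in>J. i \<noteq> j \<longrightarrow> 6 * m < l1 (chain a v i - chain a v j)) \<and>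
      (\<forall>j\<in>J. \<exists>p\<in>crossings (chain a v j) m m. path_weight r w p \<le> \<tau>)"
proof -
  define N where "N = length p - 1"
  define x where "x i = p ! i" for i
  have pne: "p \<noteq> []" using p unfolding crossings_def lr_path_def by auto
  have len: "length p = Suc N" using pne unfolding N_def by simp
  have step: "x i \<noteq> x (Suc i)" "l1 (x i - x (Suc i)) \<le> m" if "i < N" for i
    using p that len unfolding crossings_def lr_path_def x_def by auto
  have x0: "x 0 \<in> l1_ball c n" using p pne unfolding crossings_def x_def by (simp add: hd_conv_nth)
  have xN: "x N \<notin> l1_ball c (2 * n)"
    using p pne unfolding crossings_def x_def N_def by (simp add: last_conv_nth)
  have "n < l1 (x N - x 0)"
    using x0 xN l1_triangle_diff[of "x N" c "x 0"] unfolding mem_l1_ball by linarith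
  then have far: "(9 * K + 8) * m < l1 (x N - x 0)" using n by linarith
  obtain T where T: "T 0 = 0" "\<And>j. j \<le> K \<Longrightarrow> T j \<le> N" "\<And>j. j < K \<Longrightarrow> T j < T (Suc j)"
    "\<And>i j. j < K \<Longrightarrow> T (Suc j) \<le> i \<Longrightarrow> i \<le> N \<Longrightarrow> 7 * m < l1 (x i - block h (x (T j)))"
    "\<And>j. j < K \<Longrightarrow> l1 (block h (x (T (Suc j))) - block h (x (T j))) \<le> 9 * m"
    using ex_separated_times[OF h m step(2) far] by blast
  define b where "b j = block h (x (T j))" for j
  \<comment> \<open>Restricted so that \<open>v\<close> lies in a \<open>PiE\<close>, whose
    cardinality is explicit.\<close>
  define v where "v = restrict (\<lambda>j. b (Suc j) - b j) {..<K}"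
  have vmem: "v \<in> PiE {..<K} (\<lambda>_. block_steps h (9 * CARD('d)))"
  proof -
    have "b (Suc j) - b j \<in> block_steps h (9 * CARD('d))" if "j < K" for j
      unfolding b_def using T(5)[OF that] unfolding m by (intro block_diff_mem_steps h) (simp add: ac_simps)
    then show ?thesis unfolding v_def by auto
  qed
  have ch: "chain (b 0) v j = b j" if "j \<le> K" for j
  proof -
    have "(\<Sum>i<j. v i) = (\<Sum>i<j. b (Suc i) - b i)"
      using that unfolding v_def by (intro sum.cong) auto
    then show ?thesis by (simp add: chain_def sum_lessThan_telescope)
  qed
  have bl: "l1 (y - block h y) \<le> m" for y :: "int ^ 'd" unfolding m by (rule l1_block[OF h])
  have Tmono: "T i \<le> T j" if "i \<le> j" "j \<le> K" for i j
    using that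
  proof (induction j rule: dec_induct)
    case (step j) then show ?case using T(3)[of j] by simp
  qed simp
  have sep0: "6 * m < l1 (b i - b j)" if "i < j" "j < K" for i j
  proof -
    have "7 * m < l1 (x (T j) - b i)"
      unfolding b_def using that T(2)[of j] Tmono[of "Suc i" j] by (intro T(4)) auto
    then show ?thesis
      using bl[of "x (T j)"] l1_triangle_diff[of "x (T j)" "b i" "b j"] l1_minus_commute[of "b i" "b j"]
      unfolding b_def by linarith
  qed
  define J where "J = {j\<in>{..<K}. \<exists>p\<in>crossings (b j) m m. path_weight r w p \<le> \<tau>}"
  have sep: "6 * m < l1 (chain (b 0) v i - chain (b 0) v j)" if "i \<in> J" "j \<in> J" "i \<noteq> j" for i j
    using that sep0[of i j] sep0[of j i] l1_minus_commute[of "b i" "b j"]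
    by (cases i j rule: linorder_cases) (auto simp: J_def ch)
  define S where "S j = (\<Sum>i\<in>{T j..<T (Suc j)}. lr_W r w (x i) (x (Suc i)))" for j
  have Snn: "0 \<le> S j" if "j < K" for j
    unfolding S_def using T(2)[of "Suc j"] that by (intro sum_nonneg nonneg step) auto
  \<comment> \<open>The crossing inside the piece weighs more than \<open>\<tau>\<close> because
    \<open>j\<close> is outside \<open>J\<close>; the rest of the piece has nonnegative
    weight.\<close>
  have slow: "\<tau> \<le> S j" if "j \<in> {..<K} - J" for j
  proof -
    have "x (T (Suc j)) \<notin> l1_ball (b j) (2 * m)"
      using that T(4)[of j "T (Suc j)"] T(2)[of "Suc j"] unfolding mem_l1_ball b_def by auto
    moreover have "x (T j) \<in> l1_ball (b j) m" unfolding mem_l1_ball b_def by (rule bl)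
    moreover have "x i \<noteq> x (Suc i) \<and> l1 (x i - x (Suc i)) \<le> m" if "i < T (Suc j)" for i
      using that T(2)[of "Suc j"] \<open>j \<in> {..<K} - J\<close> step[of i] by auto
    moreover have "T j \<le> T (Suc j)" using T(3)[of j] that by simp
    ultimately have "\<exists>e. T j \<le> e \<and> e \<le> T (Suc j) \<and> map x [T j..<Suc e] \<in> crossings (b j) m m"
      by (intro first_crossing) auto
    then obtain e where e: "T j \<le> e" "e \<le> T (Suc j)" "map x [T j..<Suc e] \<in> crossings (b j) m m"
      by blast
    have "\<tau> < path_weight r w (map x [T j..<Suc e])"
      using that e(3) unfolding J_def by (force simp del: upt_Suc)
    also have "\<dots> \<le> S j"
      unfolding S_def path_weight_map_upt[OF e(1)] using e that T(2)[of "Suc j"]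
      by (intro sum_mono2 nonneg step) auto
    finally show ?thesis by simp
  qed
  have "(\<Sum>j<k. S j) = (\<Sum>i\<in>{0..<T k}. lr_W r w (x i) (x (Suc i)))" if "k \<le> K" for k
    using that
  proof (induction k)
    case 0 then show ?case by (simp add: T(1))
  next
    case (Suc k)
    then show ?case
      using T(3)[of k] sum.atLeastLessThan_concat[of 0 "T k" "T (Suc k)" "\<lambda>i. lr_W r w (x i) (x (Suc i))"]
      by (simp add: S_def)
  qed
  then have "(\<Sum>j<K. S j) = (\<Sum>i\<in>{0..<T K}. lr_W r w (x i) (x (Suc i)))" by simp
  also have "\<dots> \<le> (\<Sum>i<N. lr_W r w (x i) (x (Suc i)))"
    using T(2)[of K] by (intro sum_mono2 nonneg step) auto
  also have "\<dots> \<le> t" using t(1) unfolding path_weight_def N_def x_def .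
  finally have total: "(\<Sum>j<K. S j) \<le> t" .
  have "K \<le> 2 * card J"
  proof (rule ccontr)
    assume less: "\<not> K \<le> 2 * card J"
    have cJ: "card ({..<K} - J) = K - card J"
      unfolding J_def by (subst card_Diff_subset) auto
    have "card J \<le> K" using card_mono[of "{..<K}" J] by (auto simp: J_def)
    have "real K * \<tau> < 2 * (real (K - card J) * \<tau>)"
      using less \<tau> \<open>card J \<le> K\<close> by (simp add: of_nat_diff)
    also have "real (K - card J) * \<tau> \<le> (\<Sum>j\<in>{..<K} - J. S j)"
      using sum_bounded_below[of "{..<K} - J" \<tau> S] slow cJ by simp
    also have "\<dots> \<le> (\<Sum>j<K. S j)" by (intro sum_mono2) (auto intro: Snn)
    finally show False using total t(2) by linarith
  qed
  moreover have "b 0 \<in> block h ` l1_ball c n" using x0 unfolding b_def T(1) by blast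
  moreover have "\<exists>p\<in>crossings (chain (b 0) v j) m m. path_weight r w p \<le> \<tau>" if "j \<in> J" for j
    using that unfolding J_def by (auto simp: ch)
  moreover have "J \<in> Pow {..<K}" unfolding J_def by auto
  ultimately show ?thesis using vmem sep by blast
qed

text \<open>A gap of length \<open>m\<close> is bridged by one long edge, leaving two gaps of length at most \<open>m / q\<close>.
  Iterating, at most \<open>2 m\<^sup>\<kappa> - 1\<close> edges are used, with \<open>\<kappa>\<close> arbitrarily small when \<open>q\<close> is large.\<close>

lemma ex_hierarchical_path:
  fixes w :: "(int ^ 'd::finite) set \<Rightarrow> real"
  assumes q: "3 \<le> q" "2 \<le> real q powr \<kappa>" and \<kappa>: "0 < \<kappa>" and \<tau>: "0 \<le> \<tau>"
    and bridge: "\<And>a b. a \<noteq> b \<Longrightarrow> l1 a \<le> R \<Longrightarrow> l1 b \<le> R \<Longrightarrow>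
      \<exists>u\<in>l1_ball a (l1 (a - b) div q). \<exists>v\<in>l1_ball b (l1 (a - b) div q). u \<noteq> v \<and> lr_W r w u v \<le> \<tau>"
    and ab: "max (l1 a) (l1 b) + l1 (a - b) \<le> R"
  shows "\<exists>p. lr_path p \<and> hd p = a \<and> last p = b \<and>
    path_weight r w p \<le> (if a = b then 0 else 2 * real (l1 (a - b)) powr \<kappa> - 1) * \<tau>"
  using ab
proof (induction "l1 (a - b)" arbitrary: a b rule: less_induct)
  case less
  show ?case
  proof (cases "a = b")
    case True
    then show ?thesis by (intro exI[of _ "[a]"]) simp
  next
    case False
    define m where "m = l1 (a - b)"
    have "m > 0" using False unfolding m_def by simp
    have mq: "2 * (m div q) < m"
    proof -
      have "3 * (m div q) \<le> q * (m div q)" using q(1) by simp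
      also have "\<dots> \<le> m" by simp
      finally show ?thesis using \<open>m > 0\<close> by linarith
    qed
    obtain u v where uv: "u \<in> l1_ball a (m div q)" "v \<in> l1_ball b (m div q)" "u \<noteq> v" "lr_W r w u v \<le> \<tau>"
      using bridge[OF False] less.prems unfolding m_def by (meson add_leD1 max.bounded_iff)
    have au: "l1 (a - u) \<le> m div q" and vb: "l1 (v - b) \<le> m div q"
      using uv(1,2) l1_minus_commute[of a u] unfolding mem_l1_ball by auto
    \<comment> \<open>Here \<open>q\<close> powr \<open>\<kappa>\<close> being at least 2 pays for
      the branching: a gap of length at most \<open>m div q\<close> costs at most \<open>m\<close>
      powr \<open>\<kappa>\<close> minus 1. Two gaps and one edge then add up to twice
      \<open>m\<close> powr \<open>\<kappa>\<close> minus 1, so subtracting 1 in the claim is what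
      closes the induction.\<close>
    have gap: "(if y = z then 0 else 2 * real (l1 (y - z)) powr \<kappa> - 1) \<le> real m powr \<kappa> - 1"
      if "l1 (y - z) \<le> m div q" for y z :: "int ^ 'd"
    proof (cases "y = z")
      case True
      then show ?thesis using \<open>m > 0\<close> \<kappa> by (simp add: ge_one_powr_ge_zero)
    next
      case False
      have "real q * real (l1 (y - z)) \<le> real m"
      proof -
        have "q * l1 (y - z) \<le> q * (m div q)" using that by simp
        also have "\<dots> \<le> m" by simp
        finally show ?thesis by (metis of_nat_le_iff of_nat_mult)
      qed
      then have "real q powr \<kappa> * real (l1 (y - z)) powr \<kappa> \<le> real m powr \<kappa>"
        using \<kappa> by (subst powr_mult[symmetric]) (auto intro!: powr_mono2)
      moreover have "2 * real (l1 (y - z)) powr \<kappa> \<le> real q powr \<kappa> * real (l1 (y - z)) powr \<kappa>"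
        using q(2) by (intro mult_right_mono) auto
      ultimately have "2 * real (l1 (y - z)) powr \<kappa> \<le> real m powr \<kappa>" by (rule order_trans[rotated])
      then show ?thesis using False by simp
    qed
    \<comment> \<open>The domain condition is inherited: the new endpoint and the new gap together
      add at most \<open>2 * (m div q)\<close>, which is below the old gap \<open>m\<close>.\<close>
    have "max (l1 a) (l1 u) + l1 (a - u) \<le> R"
      using l1_triangle[of "u - a" a] l1_minus_commute[of u a] au mq less.prems unfolding m_def[symmetric] by simp
    moreover have "l1 (a - u) < l1 (a - b)" using au mq unfolding m_def by linarith
    ultimately obtain p1 where p1: "lr_path p1" "hd p1 = a" "last p1 = u"
      "path_weight r w p1 \<le> (if a = u then 0 else 2 * real (l1 (a - u)) powr \<kappa> - 1) * \<tau>"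
      using less.hyps by blast
    have "max (l1 v) (l1 b) + l1 (v - b) \<le> R"
      using l1_triangle[of "v - b" b] vb mq less.prems unfolding m_def[symmetric] by simp
    moreover have "l1 (v - b) < l1 (a - b)" using vb mq unfolding m_def by linarith
    ultimately obtain p2 where p2: "lr_path p2" "hd p2 = v" "last p2 = b"
      "path_weight r w p2 \<le> (if v = b then 0 else 2 * real (l1 (v - b)) powr \<kappa> - 1) * \<tau>"
      using less.hyps by blast
    have e: "lr_path [u, v]" "hd [u, v] = u" "last [u, v] = v" using uv(3) by (simp_all add: lr_path_Cons2)
    obtain p3 where p3: "lr_path p3" "hd p3 = a" "last p3 = v"
      "path_weight r w p3 = path_weight r w p1 + path_weight r w [u, v]"
      using ex_path_trans[OF p1(1-3) e] by blast
    obtain p4 where p4: "lr_path p4" "hd p4 = a" "last p4 = b"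
      "path_weight r w p4 = path_weight r w p3 + path_weight r w p2"
      using ex_path_trans[OF p3(1-3) p2(1-3)] by blast
    have "path_weight r w p4 \<le> (real m powr \<kappa> - 1) * \<tau> + \<tau> + (real m powr \<kappa> - 1) * \<tau>"
      unfolding p4(4) p3(4)
      using order_trans[OF p1(4) mult_right_mono[OF gap[OF au] \<tau>]]
        order_trans[OF p2(4) mult_right_mono[OF gap[OF vb] \<tau>]] uv(4)
      unfolding path_weight_Cons2 path_weight_singleton by linarith
    also have "\<dots> = (if a = b then 0 else 2 * real (l1 (a - b)) powr \<kappa> - 1) * \<tau>"
      using False by (simp add: m_def algebra_simps)
    finally show ?thesis using p4 by blast
  qed
qed

section \<open>Power bounds for the rate function\<close>

text \<open>A Potter-type bound from a single ratio: the doubling inequality is iterated along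
  \<open>2 ^ j * k0\<close>, monotonicity fills the gaps by rounding down, and the finitely many
  small \<open>k\<close> go into the constant.\<close>

lemma doubling_upper_bound:
  fixes r :: "nat \<Rightarrow> real"
  assumes pos: "\<And>k. 1 \<le> k \<Longrightarrow> 0 < r k"
    and mono: "\<And>k m. 1 \<le> k \<Longrightarrow> k \<le> m \<Longrightarrow> r m \<le> r k"
    and ev: "eventually (\<lambda>k. r (2 * k) \<le> 2 powr (- \<gamma>) * r k) sequentially" and \<gamma>: "0 < \<gamma>"
  shows "\<exists>C>0. \<forall>k\<ge>1. r k \<le> C * real k powr (- \<gamma>)"
proof -
  obtain k1 where k1: "\<And>k. k1 \<le> k \<Longrightarrow> r (2 * k) \<le> 2 powr (- \<gamma>) * r k"
    using ev unfolding eventually_sequentially by blast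
  define k0 where "k0 = max 1 k1"
  have k0: "k0 \<ge> 1" "k0 \<ge> k1" unfolding k0_def by auto
  have dyadic: "r (2 ^ j * k0) \<le> (2 ^ j) powr (- \<gamma>) * r k0" for j
  proof (induction j)
    case (Suc j)
    have "1 * k0 \<le> 2 ^ j * k0" by (intro mult_right_mono) auto
    then have "k1 \<le> 2 ^ j * k0" using k0 by linarith
    then have "r (2 * (2 ^ j * k0)) \<le> 2 powr (- \<gamma>) * r (2 ^ j * k0)" by (rule k1)
    also have "\<dots> \<le> 2 powr (- \<gamma>) * ((2 ^ j) powr (- \<gamma>) * r k0)" using Suc by (intro mult_left_mono) auto
    finally show ?case by (simp add: powr_mult mult.assoc)
  qed simp
  \<comment> \<open>The power of \<open>k0\<close> accounts for starting the iteration at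
    \<open>k0\<close>, the power of 2 for rounding down to a dyadic multiple; \<open>r 1\<close>
    dominates both \<open>r k0\<close> and every \<open>r k\<close> with
    \<open>k < k0\<close>.\<close>
  define C where "C = r 1 * (2 * real k0) powr \<gamma>"
  have "C > 0" unfolding C_def using pos[of 1] k0 by simp
  moreover have "r k \<le> C * real k powr (- \<gamma>)" if k: "1 \<le> k" for k
  proof (cases "k0 \<le> k")
    case True
    then have "1 \<le> k div k0" using k0 by (simp add: div_greater_zero_iff Suc_le_eq)
    then obtain j where j: "2 ^ j \<le> k div k0" "k div k0 < 2 ^ (j + 1)"
      using ex_power_ivl1[of 2 "k div k0"] by auto
    have lo: "2 ^ j * k0 \<le> k" using j(1) by (metis div_times_less_eq_dividend le_trans mult_le_mono1)
    have "k < 2 ^ (j + 1) * k0" using j(2) k0 by (simp add: div_less_iff_less_mult)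
    then have "real k < real (2 ^ (j + 1) * k0)" by (rule less_imp_of_nat_less)
    then have hi: "real k / (2 * real k0) \<le> 2 ^ j" using k0 by (simp add: field_simps)
    have "r k \<le> r (2 ^ j * k0)" using lo k0 by (intro mono) auto
    also have "\<dots> \<le> (2 ^ j) powr (- \<gamma>) * r k0" by (rule dyadic)
    also have "\<dots> \<le> (real k / (2 * real k0)) powr (- \<gamma>) * r 1"
      using hi k k0 \<gamma> mono[of 1 k0] pos[of k0] by (intro mult_mono powr_mono2') auto
    also have "\<dots> = C * real k powr (- \<gamma>)"
      unfolding C_def using k k0 by (simp add: powr_divide powr_minus field_simps)
    finally show ?thesis .
  next
    case False
    have "r k \<le> r 1 * 1" using k mono[of 1 k] by simp
    also have "\<dots> \<le> r 1 * ((2 * real k0) / real k) powr \<gamma>"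
      using False k \<gamma> pos[of 1] by (intro mult_left_mono ge_one_powr_ge_zero) auto
    also have "\<dots> = C * real k powr (- \<gamma>)"
      unfolding C_def using k k0 by (simp add: powr_divide powr_minus field_simps)
    finally show ?thesis .
  qed
  ultimately show ?thesis by blast
qed

text \<open>Same scheme with rounding up to the next dyadic multiple \<open>2 ^ Suc j * k0\<close>.
  Since \<open>2 ^ Suc j\<close> is at most \<open>2 * k\<close>, this costs the factor
  \<open>2 powr (- \<gamma>)\<close>.\<close>

lemma doubling_lower_bound:
  fixes r :: "nat \<Rightarrow> real"
  assumes pos: "\<And>k. 1 \<le> k \<Longrightarrow> 0 < r k"
    and mono: "\<And>k m. 1 \<le> k \<Longrightarrow> k \<le> m \<Longrightarrow> r m \<le> r k"
    and ev: "eventually (\<lambda>k. 2 powr (- \<gamma>) * r k \<le> r (2 * k)) sequentially" and \<gamma>: "0 < \<gamma>"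
  shows "\<exists>c>0. \<forall>k\<ge>1. c * real k powr (- \<gamma>) \<le> r k"
proof -
  obtain k1 where k1: "\<And>k. k1 \<le> k \<Longrightarrow> 2 powr (- \<gamma>) * r k \<le> r (2 * k)"
    using ev unfolding eventually_sequentially by blast
  define k0 where "k0 = max 1 k1"
  have k0: "k0 \<ge> 1" "k0 \<ge> k1" unfolding k0_def by auto
  have dyadic: "(2 ^ j) powr (- \<gamma>) * r k0 \<le> r (2 ^ j * k0)" for j
  proof (induction j)
    case (Suc j)
    have "1 * k0 \<le> 2 ^ j * k0" by (intro mult_right_mono) auto
    then have "k1 \<le> 2 ^ j * k0" using k0 by linarith
    then have "2 powr (- \<gamma>) * r (2 ^ j * k0) \<le> r (2 * (2 ^ j * k0))" by (rule k1)
    moreover have "2 powr (- \<gamma>) * ((2 ^ j) powr (- \<gamma>) * r k0) \<le> 2 powr (- \<gamma>) * r (2 ^ j * k0)"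
      using Suc by (intro mult_left_mono) auto
    ultimately have "2 powr (- \<gamma>) * ((2 ^ j) powr (- \<gamma>) * r k0) \<le> r (2 * (2 ^ j * k0))"
      by (rule order_trans[rotated])
    then show ?case by (simp add: powr_mult mult.assoc)
  qed simp
  define c where "c = r k0 * 2 powr (- \<gamma>)"
  have "c > 0" unfolding c_def using pos[of k0] k0 by simp
  moreover have "c * real k powr (- \<gamma>) \<le> r k" if k: "1 \<le> k" for k
  proof (cases "k0 \<le> k")
    case True
    then have "1 \<le> k div k0" using k0 by (simp add: div_greater_zero_iff Suc_le_eq)
    then obtain j where j: "2 ^ j \<le> k div k0" "k div k0 < 2 ^ (j + 1)"
      using ex_power_ivl1[of 2 "k div k0"] by auto
    have "2 ^ j \<le> k" using j(1) by (meson div_le_dividend le_trans)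
    then have "real (2 ^ j) \<le> real k" by (rule of_nat_mono)
    then have lo: "2 ^ (Suc j) \<le> 2 * real k" by simp
    have hi: "k < 2 ^ Suc j * k0" using j(2) k0 by (simp add: div_less_iff_less_mult)
    have "c * real k powr (- \<gamma>) = (2 * real k) powr (- \<gamma>) * r k0"
      unfolding c_def using k by (simp add: powr_mult)
    also have "\<dots> \<le> (2 ^ Suc j) powr (- \<gamma>) * r k0"
      using lo \<gamma> pos[of k0] k0 by (intro mult_right_mono powr_mono2') auto
    also have "\<dots> \<le> r (2 ^ Suc j * k0)" by (rule dyadic)
    also have "\<dots> \<le> r k" using hi k by (intro mono) auto
    finally show ?thesis .
  next
    case False
    have "c * real k powr (- \<gamma>) = r k0 * (2 * real k) powr (- \<gamma>)"
      unfolding c_def using k by (simp add: powr_mult)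
    also have "\<dots> \<le> r k0 * 1"
    proof (rule mult_left_mono)
      have "1 \<le> (2 * real k) powr \<gamma>" using k \<gamma> by (intro ge_one_powr_ge_zero) auto
      then show "(2 * real k) powr (- \<gamma>) \<le> 1" by (simp add: powr_minus inverse_le_1_iff)
    qed (use pos[of k0] k0 in simp)
    also have "\<dots> \<le> r k" using False k mono[of k k0] by simp
    finally show ?thesis .
  qed
  ultimately show ?thesis by blast
qed

lemma slowly_varying_doubling:
  assumes L: "slowly_varying L" and r: "\<And>k. 1 \<le> k \<Longrightarrow> r k = real k powr (- \<alpha>) * L (real k)"
  shows "(\<lambda>k. r (2 * k) / r k) \<longlonglongrightarrow> 2 powr (- \<alpha>)"
proof -
  have "((\<lambda>x. L (2 * x) / L x) \<longlongrightarrow> 1) at_top"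
    using L unfolding slowly_varying_def by auto
  then have "(\<lambda>k. L (2 * real k) / L (real k)) \<longlonglongrightarrow> 1"
    by (rule filterlim_compose[OF _ filterlim_real_sequentially])
  then have "(\<lambda>k. 2 powr (- \<alpha>) * (L (2 * real k) / L (real k))) \<longlonglongrightarrow> 2 powr (- \<alpha>) * 1"
    by (intro tendsto_mult tendsto_const)
  moreover have "eventually (\<lambda>k. 2 powr (- \<alpha>) * (L (2 * real k) / L (real k)) = r (2 * k) / r k) sequentially"
    using eventually_ge_at_top[of 1]
    by eventually_elim (auto simp: r powr_mult)
  ultimately show ?thesis using tendsto_cong by force
qed

section \<open>Probability estimates\<close>

text \<open>The slowly varying factor is replaced by \<open>r_upper\<close> and
  \<open>r_lower\<close>, power bounds with every exponent on either side of \<alpha>; the final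
  theorem derives them.\<close>

locale lr_fpp = prob_space M
  for M :: "'a measure" +
  fixes \<omega> :: "(int ^ 'd::finite) set \<Rightarrow> 'a \<Rightarrow> real" and r :: "nat \<Rightarrow> real" and \<alpha> :: real
  assumes indep: "indep_vars (\<lambda>_. borel) \<omega> lr_edges"
    and exponential: "\<And>e. e \<in> lr_edges \<Longrightarrow> distributed M lborel (\<omega> e) (exponential_density 1)"
    and r_pos: "\<And>k. 1 \<le> k \<Longrightarrow> 0 < r k"
    and r_mono: "\<And>k m. 1 \<le> k \<Longrightarrow> k \<le> m \<Longrightarrow> r m \<le> r k"
    and r_upper: "\<And>\<gamma>. 0 < \<gamma> \<Longrightarrow> \<gamma> < \<alpha> \<Longrightarrow> \<exists>C>0. \<forall>k\<ge>1. r k \<le> C * real k powr (- \<gamma>)"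
    and r_lower: "\<And>\<gamma>. \<alpha> < \<gamma> \<Longrightarrow> \<exists>c>0. \<forall>k\<ge>1. c * real k powr (- \<gamma>) \<le> r k"
    and \<alpha>_gt: "2 * real CARD('d) < \<alpha>" and \<alpha>_less: "\<alpha> < 2 * real CARD('d) + 1"
begin

abbreviation wt :: "'a \<Rightarrow> (int ^ 'd) set \<Rightarrow> real" where
  "wt s \<equiv> \<lambda>e. \<omega> e s"

lemma d_ge_1: "1 \<le> CARD('d)"
  by (simp add: Suc_le_eq)

lemma edge_mem: "x \<noteq> y \<Longrightarrow> {x, y} \<in> lr_edges"
  unfolding lr_edges_def by blast

lemma rate_pos: "x \<noteq> y \<Longrightarrow> 0 < r (l1 (x - y))"
  by (rule r_pos) (simp add: Suc_le_eq)

lemma measurable_\<omega> [measurable]: "e \<in> lr_edges \<Longrightarrow> \<omega> e \<in> borel_measurable M"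
  using distributed_measurable[OF exponential] by simp

lemma measurable_lr_W [measurable]: "x \<noteq> y \<Longrightarrow> (\<lambda>s. lr_W r (wt s) x y) \<in> borel_measurable M"
  unfolding lr_W_def by (intro borel_measurable_divide measurable_\<omega> edge_mem borel_measurable_const)

lemma measurable_path_weight:
  assumes "lr_path p"
  shows "(\<lambda>s. path_weight r (wt s) p) \<in> borel_measurable M"
  unfolding path_weight_def using assms
  by (intro borel_measurable_sum measurable_lr_W) (auto simp: lr_path_def)

text \<open>There are countably many lattice paths, so the event is a countable union.\<close>

lemma sets_ex_path [measurable]:
  assumes "P \<subseteq> Collect lr_path"
  shows "{s\<in>space M. \<exists>p\<in>P. path_weight r (wt s) p \<le> \<tau>} \<in> events"
proof -
  have "{s\<in>space M. \<exists>p\<in>P. path_weight r (wt s) p \<le> \<tau>} =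
      (\<Union>p\<in>P. {s\<in>space M. path_weight r (wt s) p \<le> \<tau>})" by auto
  also have "\<dots> \<in> events"
    using measurable_path_weight assms
    by (intro sets.countable_UN'') (auto intro: countable_subset[OF subset_UNIV] borel_measurable_le)
  finally show ?thesis .
qed

lemma crossings_subset: "crossings c m l \<subseteq> Collect lr_path"
  unfolding crossings_def by auto

lemma prob_edge_le:
  assumes "x \<noteq> y" "0 \<le> \<tau>"
  shows "prob {s\<in>space M. lr_W r (wt s) x y \<le> \<tau>} \<le> r (l1 (x - y)) * \<tau>"
proof -
  let ?r = "r (l1 (x - y))"
  have rp: "0 < ?r" by (rule rate_pos[OF assms(1)])
  have "{s\<in>space M. lr_W r (wt s) x y \<le> \<tau>} = {s\<in>space M. \<omega> {x, y} s \<le> ?r * \<tau>}"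
    unfolding lr_W_def using rp by (auto simp: field_simps)
  then have "prob {s\<in>space M. lr_W r (wt s) x y \<le> \<tau>} = 1 - exp (- (?r * \<tau>) * 1)"
    using exponential_distributedD_le[OF exponential[OF edge_mem[OF assms(1)]], of "?r * \<tau>"] rp assms(2) by simp
  also have "\<dots> \<le> ?r * \<tau>" using exp_ge_add_one_self[of "- (?r * \<tau>)"] by simp
  finally show ?thesis .
qed

lemma countable_lr_edges: "countable (lr_edges :: (int ^ 'd) set set)"
proof (rule countable_subset)
  show "lr_edges \<subseteq> (\<lambda>(x, y). {x, y}) ` (UNIV :: ((int ^ 'd) \<times> (int ^ 'd)) set)"
    unfolding lr_edges_def by auto
qed simp

text \<open>Exponential weights are nonnegative only almost surely, and dropping edges from a path
  lowers its weight only where they are. Pathwise arguments run on this event;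
  \<open>prob_Int_nonneg\<close> removes it afterwards.\<close>

definition nonneg_event :: "'a set" where
  "nonneg_event = {s\<in>space M. \<forall>e\<in>lr_edges. 0 \<le> \<omega> e s}"

lemma sets_nonneg_event [measurable]: "nonneg_event \<in> events"
proof -
  have "nonneg_event = space M - (\<Union>e\<in>lr_edges. {s\<in>space M. \<omega> e s < 0})"
    unfolding nonneg_event_def by (auto simp: not_le)
  also have "\<dots> \<in> events"
    using countable_lr_edges
    by (intro sets.Diff sets.top sets.countable_UN'') (auto intro: borel_measurable_less)
  finally show ?thesis .
qed

lemma AE_nonneg_event: "AE s in M. s \<in> nonneg_event"
proof -
  have "AE s in M. 0 \<le> \<omega> e s" if "e \<in> lr_edges" for e
  proof -
    have "prob {s\<in>space M. 0 < \<omega> e s} = 1"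
      using exponential_distributedD_gt[OF exponential[OF that], of 0] by simp
    then have "AE s in M. 0 < \<omega> e s"
      using measurable_\<omega>[OF that] by (subst (asm) prob_Collect_eq_1) auto
    then show ?thesis by eventually_elim simp
  qed
  then have "AE s in M. \<forall>e\<in>lr_edges. 0 \<le> \<omega> e s"
    by (simp add: AE_ball_countable countable_lr_edges)
  then show ?thesis unfolding nonneg_event_def by auto
qed

lemma nonneg_W: "s \<in> nonneg_event \<Longrightarrow> x \<noteq> y \<Longrightarrow> 0 \<le> lr_W r (wt s) x y"
  unfolding lr_W_def nonneg_event_def using edge_mem[of x y] rate_pos[of x y]
  by (auto intro!: divide_nonneg_pos)

lemma prob_Int_nonneg: "A \<in> events \<Longrightarrow> prob (A \<inter> nonneg_event) = prob A"
  using AE_nonneg_event by (intro finite_measure_eq_AE) auto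

section \<open>First-moment bounds for long edges and for missing bridges\<close>

definition long_edge_event :: "int ^ 'd \<Rightarrow> nat \<Rightarrow> nat \<Rightarrow> real \<Rightarrow> 'a set" where
  "long_edge_event c R m \<tau> =
    {s\<in>space M. \<exists>x\<in>l1_ball c R. \<exists>y. x \<noteq> y \<and> m \<le> l1 (x - y) \<and> lr_W r (wt s) x y \<le> \<tau>}"

lemma sets_long_edge_event [measurable]: "long_edge_event c R m \<tau> \<in> events"
proof -
  have "long_edge_event c R m \<tau> =
    (\<Union>x\<in>l1_ball c R. \<Union>y\<in>{y. x \<noteq> y \<and> m \<le> l1 (x - y)}. {s\<in>space M. lr_W r (wt s) x y \<le> \<tau>})"
    unfolding long_edge_event_def by auto
  also have "\<dots> \<in> events"
    by (intro sets.countable_UN'') (auto intro: countable_subset[OF subset_UNIV] borel_measurable_le measurable_lr_W)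
  finally show ?thesis .
qed

text \<open>Union bound over sites and dyadic shells. A shell at distance \<open>2 ^ j * m\<close>
  has at most \<open>(5 * 2 ^ j * m) ^ CARD('d)\<close> endpoints, each cheap with probability at
  most its rate times \<open>\<tau>\<close>. The shells form a geometric series with ratio
  \<open>2 powr (d - \<gamma>)\<close>, below 1 because \<open>\<gamma>\<close> exceeds the
  dimension d.\<close>

lemma prob_long_edge_le:
  assumes \<gamma>: "real CARD('d) < \<gamma>" "\<gamma> < \<alpha>"
  shows "\<exists>C>0. \<forall>c R m \<tau>. 1 \<le> m \<longrightarrow> 0 \<le> \<tau> \<longrightarrow>
    prob (long_edge_event c R m \<tau>) \<le> C * real (2 * R + 1) ^ CARD('d) * \<tau> * real m powr (real CARD('d) - \<gamma>)"
proof -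
  let ?d = "real CARD('d)"
  obtain C0 where C0: "C0 > 0" "\<And>k. 1 \<le> k \<Longrightarrow> r k \<le> C0 * real k powr (- \<gamma>)"
    using r_upper[of \<gamma>] \<gamma> by auto
  define \<rho> where "\<rho> = 2 powr (?d - \<gamma>)"
  have "\<rho> < 2 powr 0" unfolding \<rho>_def using \<gamma> by (intro powr_less_mono) auto
  then have \<rho>: "0 < \<rho>" "\<rho> < 1" unfolding \<rho>_def by auto
  define C where "C = 5 ^ CARD('d) * C0 / (1 - \<rho>)"
  have "C > 0" unfolding C_def using C0 \<rho> by simp
  moreover have "prob (long_edge_event c R m \<tau>) \<le> C * real (2 * R + 1) ^ CARD('d) * \<tau> * real m powr (?d - \<gamma>)"
    if m: "1 \<le> m" and \<tau>: "0 \<le> \<tau>" for c R m \<tau>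
  proof -
    define Y where "Y x j = {y\<in>l1_ball x (2 ^ Suc j * m). 2 ^ j * m \<le> l1 (x - y)}" for x :: "int ^ 'd" and j
    have Yne: "y \<noteq> x" if "y \<in> Y x j" for x y j
    proof -
      have "0 < 2 ^ j * m" using m by simp
      then show ?thesis using that unfolding Y_def by auto
    qed
    have finY: "finite (Y x j)" for x j unfolding Y_def by simp
    define E where "E x y = {s\<in>space M. lr_W r (wt s) x y \<le> \<tau>}" for x y
    have E_ev: "E x y \<in> events" if "x \<noteq> y" for x y
      unfolding E_def using that by (intro borel_measurable_le measurable_lr_W) auto
    define A where "A x j = (\<Union>y\<in>Y x j. E x y)" for x j
    have A_ev: "A x j \<in> events" for x j
      unfolding A_def using finY by (intro sets.finite_UN E_ev) (auto dest: Yne)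
    have pA: "prob (A x j) \<le> 5 ^ CARD('d) * C0 * \<tau> * real m powr (?d - \<gamma>) * \<rho> ^ j" for x j
    proof -
      define k where "k = 2 ^ j * m"
      have k: "1 \<le> k" unfolding k_def using m by simp
      have "prob (A x j) \<le> (\<Sum>y\<in>Y x j. prob (E x y))"
        unfolding A_def using finY by (intro finite_measure_subadditive_finite) (auto intro!: E_ev dest: Yne)
      also have "\<dots> \<le> (\<Sum>y\<in>Y x j. r k * \<tau>)"
      proof (rule sum_mono)
        fix y assume y: "y \<in> Y x j"
        have "prob (E x y) \<le> r (l1 (x - y)) * \<tau>"
          unfolding E_def using Yne[OF y] \<tau> by (intro prob_edge_le) auto
        also have "\<dots> \<le> r k * \<tau>"
          using y k \<tau> unfolding Y_def k_def[symmetric] by (intro mult_right_mono r_mono) simp_all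
        finally show "prob (E x y) \<le> r k * \<tau>" .
      qed
      also have "\<dots> = real (card (Y x j)) * (r k * \<tau>)" by simp
      also have "\<dots> \<le> (5 * real k) ^ CARD('d) * (C0 * real k powr (- \<gamma>) * \<tau>)"
      proof (intro mult_mono mult_right_mono)
        have "card (Y x j) \<le> card (l1_ball x (2 * k))" unfolding Y_def k_def by (intro card_mono) (auto simp: mult.assoc)
        also have "\<dots> \<le> (2 * (2 * k) + 1) ^ CARD('d)" by (rule card_l1_ball_le)
        also have "\<dots> \<le> (5 * k) ^ CARD('d)" using k by (intro power_mono) auto
        finally show "real (card (Y x j)) \<le> (5 * real k) ^ CARD('d)"
          by (metis of_nat_le_iff of_nat_mult of_nat_numeral of_nat_power)
      qed (use C0(2)[OF k] \<tau> r_pos[OF k] in auto)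
      also have "\<dots> = 5 ^ CARD('d) * C0 * \<tau> * (real k powr ?d * real k powr (- \<gamma>))"
        using k by (simp add: power_mult_distrib powr_realpow)
      also have "real k powr ?d * real k powr (- \<gamma>) = real k powr (?d - \<gamma>)"
        by (simp add: powr_add[symmetric])
      also have "\<dots> = real m powr (?d - \<gamma>) * \<rho> ^ j"
        unfolding k_def \<rho>_def by (simp add: powr_mult powr_realpow[symmetric] powr_powr mult.commute)
      finally show ?thesis by (simp add: mult.assoc)
    qed
    define B where "B = 5 ^ CARD('d) * C0 * \<tau> * real m powr (?d - \<gamma>)"
    have sg: "summable (\<lambda>j. B * \<rho> ^ j)" using \<rho> by (intro summable_mult summable_geometric) auto
    have U_ev: "(\<Union>j. A x j) \<in> events" for x using A_ev by auto
    have pU: "prob (\<Union>j. A x j) \<le> B / (1 - \<rho>)" for x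
    proof -
      have sA: "summable (\<lambda>j. prob (A x j))"
        by (rule summable_comparison_test'[OF sg, of 0]) (use pA in \<open>auto simp: B_def\<close>)
      have "prob (\<Union>j. A x j) \<le> (\<Sum>j. prob (A x j))"
        using A_ev sA by (intro finite_measure_subadditive_countably) auto
      also have "\<dots> \<le> (\<Sum>j. B * \<rho> ^ j)" by (rule suminf_le[OF _ sA sg]) (use pA in \<open>auto simp: B_def\<close>)
      also have "\<dots> = B / (1 - \<rho>)" using \<rho> by (simp add: suminf_mult suminf_geometric divide_inverse)
      finally show ?thesis .
    qed
    have sub: "long_edge_event c R m \<tau> \<subseteq> (\<Union>x\<in>l1_ball c R. \<Union>j. A x j)"
    proof
      fix s assume "s \<in> long_edge_event c R m \<tau>"
      then obtain x y where xy: "s \<in> space M" "x \<in> l1_ball c R" "x \<noteq> y" "m \<le> l1 (x - y)" "lr_W r (wt s) x y \<le> \<tau>"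
        unfolding long_edge_event_def by auto
      have "1 \<le> l1 (x - y) div m" using xy(4) m by (simp add: div_greater_zero_iff Suc_le_eq)
      then obtain j where j: "2 ^ j \<le> l1 (x - y) div m" "l1 (x - y) div m < 2 ^ (j + 1)"
        using ex_power_ivl1[of 2 "l1 (x - y) div m"] by auto
      have "2 ^ j * m \<le> l1 (x - y)" using j(1) by (metis div_times_less_eq_dividend le_trans mult_le_mono1)
      moreover have "l1 (x - y) < 2 ^ Suc j * m" using j(2) m by (simp add: div_less_iff_less_mult)
      ultimately have "y \<in> Y x j" unfolding Y_def mem_l1_ball using l1_minus_commute[of x y] by simp
      then show "s \<in> (\<Union>x\<in>l1_ball c R. \<Union>j. A x j)" using xy unfolding A_def E_def by blast
    qed
    have "prob (long_edge_event c R m \<tau>) \<le> prob (\<Union>x\<in>l1_ball c R. \<Union>j. A x j)"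
      by (intro finite_measure_mono[OF sub] sets.finite_UN U_ev) simp
    also have "\<dots> \<le> (\<Sum>x\<in>l1_ball c R. prob (\<Union>j. A x j))"
      by (intro finite_measure_subadditive_finite image_subsetI U_ev finite_l1_ball)
    also have "\<dots> \<le> (\<Sum>x\<in>l1_ball c R. B / (1 - \<rho>))" by (intro sum_mono pU)
    also have "\<dots> = real (card (l1_ball c R)) * (B / (1 - \<rho>))" by simp
    also have "\<dots> \<le> real (2 * R + 1) ^ CARD('d) * (B / (1 - \<rho>))"
    proof (rule mult_right_mono)
      show "real (card (l1_ball c R)) \<le> real (2 * R + 1) ^ CARD('d)"
        using card_l1_ball_le[of c R] by (metis of_nat_le_iff of_nat_power)
    qed (use \<rho> C0 \<tau> in \<open>auto simp: B_def\<close>)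
    also have "\<dots> = C * real (2 * R + 1) ^ CARD('d) * \<tau> * real m powr (?d - \<gamma>)"
      unfolding B_def C_def by (simp add: field_simps)
    finally show ?thesis .
  qed
  ultimately show ?thesis by blast
qed

text \<open>At distance \<open>m\<close> there are at least \<open>(m / (q * d)) ^ (2 * d)\<close>
  candidate edges, with d the dimension. Each has length at most \<open>2 * m\<close>, hence rate at
  least \<open>r (2 * m)\<close>, and by independence their exponential tails multiply.\<close>

lemma prob_no_bridge_le:
  assumes q: "3 \<le> q" and \<gamma>: "\<alpha> < \<gamma>"
  shows "\<exists>c>0. \<forall>a b \<tau>. a \<noteq> b \<longrightarrow> 0 \<le> \<tau> \<longrightarrow>
    prob {s\<in>space M. \<forall>u\<in>l1_ball a (l1 (a - b) div q). \<forall>v\<in>l1_ball b (l1 (a - b) div q).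
        u \<noteq> v \<longrightarrow> \<tau> < lr_W r (wt s) u v}
      \<le> exp (- c * \<tau> * real (l1 (a - b)) powr (2 * real CARD('d) - \<gamma>))"
proof -
  let ?d = "real CARD('d)"
  obtain c0 where c0: "c0 > 0" "\<And>k. 1 \<le> k \<Longrightarrow> c0 * real k powr (- \<gamma>) \<le> r k"
    using r_lower[OF \<gamma>] by auto
  define c where "c = c0 * 2 powr (- \<gamma>) * (1 / (real q * ?d)) ^ (2 * CARD('d))"
  have "c > 0" unfolding c_def using c0 q d_ge_1 by simp
  moreover have "prob {s\<in>space M. \<forall>u\<in>l1_ball a (l1 (a - b) div q). \<forall>v\<in>l1_ball b (l1 (a - b) div q).
        u \<noteq> v \<longrightarrow> \<tau> < lr_W r (wt s) u v}
      \<le> exp (- c * \<tau> * real (l1 (a - b)) powr (2 * ?d - \<gamma>))" (is "prob ?F \<le> _")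
    if ab: "a \<noteq> b" and \<tau>: "0 \<le> \<tau>" for a b \<tau>
  proof -
    define m where "m = l1 (a - b)"
    have m: "1 \<le> m" unfolding m_def using ab by (simp add: Suc_le_eq)
    let ?A = "l1_ball a (m div q)" and ?B = "l1_ball b (m div q)"
    have mq: "2 * (m div q) < m"
    proof -
      have "3 * (m div q) \<le> q * (m div q)" using q by simp
      also have "\<dots> \<le> m" by simp
      finally show ?thesis using m by linarith
    qed
    \<comment> \<open>Disjoint balls make different pairs different edges, so \<open>card E\<close>
      is a product and no pair degenerates to a point. This is where \<open>q\<close> at least 3 is
      used.\<close>
    have disj: "?A \<inter> ?B = {}"
    proof (rule ccontr)
      assume "?A \<inter> ?B \<noteq> {}"
      then obtain x where "l1 (x - a) \<le> m div q" "l1 (x - b) \<le> m div q" by (auto simp: mem_l1_ball)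
      then show False
        using l1_triangle_diff[of a b x] l1_minus_commute[of a x] mq unfolding m_def[symmetric] by linarith
    qed
    define E where "E = (\<lambda>(u, v). {u, v}) ` (?A \<times> ?B)"
    have inj: "inj_on (\<lambda>(u, v). {u, v}) (?A \<times> ?B)"
      using disj by (auto simp: inj_on_def doubleton_eq_iff)
    have cE: "card E = card ?A * card ?B"
      unfolding E_def by (simp add: card_image[OF inj] card_cartesian_product)
    have E: "finite E" "E \<subseteq> lr_edges" unfolding E_def using disj by (auto intro!: edge_mem)
    have ball_ge: "(real m / (real q * ?d)) ^ CARD('d) \<le> real (card (l1_ball x (m div q)))" for x :: "int ^ 'd"
    proof -
      \<comment> \<open>The side \<open>2 * k + 1\<close> exceeds \<open>m / (q * d)\<close> even
        when \<open>k = 0\<close>, so short distances need no separate treatment.\<close>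
      define k where "k = m div (q * CARD('d))"
      have "m < q * CARD('d) * (k + 1)"
        unfolding k_def using q d_ge_1 dividend_less_times_div[of "q * CARD('d)" m] by simp
      also have "\<dots> \<le> q * CARD('d) * (2 * k + 1)" by (intro mult_left_mono) auto
      finally have "real m \<le> real (q * CARD('d) * (2 * k + 1))" by (intro of_nat_mono less_imp_le)
      then have "real m / (real q * ?d) \<le> real (2 * k + 1)"
        using q d_ge_1 by (subst pos_divide_le_eq) (simp_all add: algebra_simps)
      then have "(real m / (real q * ?d)) ^ CARD('d) \<le> real (2 * k + 1) ^ CARD('d)"
        by (intro power_mono) auto
      also have "\<dots> \<le> real (card (l1_ball x (m div q)))"
        using card_l1_ball_ge[where c = x and n = "m div q"]
        unfolding k_def div_mult2_eq of_nat_power[symmetric] of_nat_le_iff .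
      finally show ?thesis .
    qed
    have "(real m / (real q * ?d)) ^ CARD('d) * (real m / (real q * ?d)) ^ CARD('d)
        \<le> real (card ?A) * real (card ?B)"
      by (intro mult_mono ball_ge) auto
    then have cEge: "(real m / (real q * ?d)) ^ (2 * CARD('d)) \<le> real (card E)"
      unfolding cE by (simp add: power_add[symmetric] mult_2)
    \<comment> \<open>The product rule for independent events needs a nonempty index set.\<close>
    have "(a, b) \<in> ?A \<times> ?B" by (simp add: mem_l1_ball)
    then have Ene: "E \<noteq> {}" unfolding E_def by blast
    have "c * real m powr (2 * ?d - \<gamma>) =
        (c0 * real (2 * m) powr (- \<gamma>)) * (real m / (real q * ?d)) ^ (2 * CARD('d))"
    proof -
      have "real m powr (2 * ?d - \<gamma>) = real m ^ (2 * CARD('d)) * real m powr (- \<gamma>)"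
        using m powr_realpow[of "real m" "2 * CARD('d)"] by (simp add: powr_diff powr_minus divide_inverse)
      then show ?thesis unfolding c_def by (simp add: powr_mult power_divide field_simps)
    qed
    also have "\<dots> \<le> r (2 * m) * real (card E)"
      using cEge c0(2)[of "2 * m"] m by (intro mult_mono) (auto intro: less_imp_le[OF r_pos])
    finally have rate: "c * real m powr (2 * ?d - \<gamma>) \<le> r (2 * m) * real (card E)" .
    have sub: "?F \<subseteq> (\<Inter>e\<in>E. \<omega> e -` {\<tau> * r (2 * m)<..} \<inter> space M)"
    proof (safe, simp_all)
      fix s e assume s: "s \<in> space M" "\<forall>u\<in>l1_ball a (l1 (a - b) div q). \<forall>v\<in>l1_ball b (l1 (a - b) div q).
        u \<noteq> v \<longrightarrow> \<tau> < lr_W r (wt s) u v" and "e \<in> E"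
      then obtain u v where uv: "e = {u, v}" "u \<in> ?A" "v \<in> ?B" unfolding E_def by auto
      have "u \<noteq> v" using uv disj by auto
      then have W: "\<tau> < lr_W r (wt s) u v" using s uv unfolding m_def by auto
      have "l1 (u - v) \<le> 2 * m"
        using uv mq l1_triangle_diff[of u v a] l1_triangle_diff[of a v b] l1_minus_commute[of v b]
        unfolding mem_l1_ball m_def[symmetric] by linarith
      then have "r (2 * m) \<le> r (l1 (u - v))" using \<open>u \<noteq> v\<close> by (intro r_mono) (auto simp: Suc_le_eq)
      then have "\<tau> * r (2 * m) \<le> \<tau> * r (l1 (u - v))" using \<tau> by (rule mult_left_mono)
      also have "\<dots> < \<omega> e s"
        using W rate_pos[OF \<open>u \<noteq> v\<close>] unfolding lr_W_def uv(1) by (simp add: field_simps)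
      finally show "\<tau> * r (2 * m) < \<omega> e s" .
    qed
    have ev: "\<omega> e -` {\<tau> * r (2 * m)<..} \<inter> space M \<in> events" if "e \<in> E" for e
      using E(2) that by (intro measurable_sets[OF measurable_\<omega>]) auto
    have "prob ?F \<le> prob (\<Inter>e\<in>E. \<omega> e -` {\<tau> * r (2 * m)<..} \<inter> space M)"
      using ev E Ene by (intro finite_measure_mono[OF sub] sets.finite_INT) auto
    also have "\<dots> = (\<Prod>e\<in>E. prob (\<omega> e -` {\<tau> * r (2 * m)<..} \<inter> space M))"
      using E Ene by (intro indep_varsD[OF indep]) auto
    also have "\<dots> = (\<Prod>e\<in>E. exp (- (\<tau> * r (2 * m))))"
    proof (rule prod.cong)
      fix e assume "e \<in> E"
      have "\<omega> e -` {\<tau> * r (2 * m)<..} \<inter> space M = {s\<in>space M. \<tau> * r (2 * m) < \<omega> e s}" by auto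
      then show "prob (\<omega> e -` {\<tau> * r (2 * m)<..} \<inter> space M) = exp (- (\<tau> * r (2 * m)))"
        using exponential_distributedD_gt[OF exponential, of e "\<tau> * r (2 * m)"] E \<open>e \<in> E\<close> \<tau> r_pos[of "2 * m"] m
        by auto
    qed simp
    also have "\<dots> = exp (- (\<tau> * (r (2 * m) * real (card E))))"
      by (simp add: exp_of_nat_mult[symmetric] mult_ac)
    also have "\<dots> \<le> exp (- (\<tau> * (c * real m powr (2 * ?d - \<gamma>))))"
      using rate \<tau> by (simp add: mult_left_mono)
    finally show ?thesis unfolding m_def by (simp add: mult_ac)
  qed
  ultimately show ?thesis by blast
qed

definition fast_event :: "int ^ 'd \<Rightarrow> nat \<Rightarrow> real \<Rightarrow> 'a set" where
  "fast_event c m \<tau> = {s\<in>space M. \<exists>p\<in>crossings c m m. path_weight r (wt s) p \<le> \<tau>}"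

lemma sets_fast_event [measurable]: "fast_event c m \<tau> \<in> events"
  unfolding fast_event_def by (rule sets_ex_path[OF crossings_subset])

text \<open>A crossing of the ball around \<open>z j\<close> uses only edges inside the ball of
  radius \<open>3 * m\<close>: vertices before the last are within \<open>2 * m\<close>, and the
  last jump is at most \<open>m\<close>. Centres more than \<open>6 * m\<close> apart give disjoint
  edge sets, hence independent events. Intersecting with \<open>space M\<close> gives the empty
  intersection its right value.\<close>

lemma prob_fast_Int_le:
  assumes J: "finite J" and \<kappa>: "\<And>j. j \<in> J \<Longrightarrow> prob (fast_event (z j) m \<tau>) \<le> \<kappa>"
    and sep: "\<And>i j. i \<in> J \<Longrightarrow> j \<in> J \<Longrightarrow> i \<noteq> j \<Longrightarrow> 6 * m < l1 (z i - z j)"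
  shows "prob (space M \<inter> (\<Inter>j\<in>J. fast_event (z j) m \<tau>)) \<le> \<kappa> ^ card J"
proof (cases "J = {}")
  case False
  define E where "E j = {{x, y} | x y. x \<noteq> y \<and> x \<in> l1_ball (z j) (3 * m) \<and> y \<in> l1_ball (z j) (3 * m)}" for j
  have Esub: "E j \<subseteq> lr_edges" for j unfolding E_def lr_edges_def by blast
  have disj: "disjoint_family_on E J"
    unfolding disjoint_family_on_def
  proof (intro ballI impI)
    fix i j assume ij: "i \<in> J" "j \<in> J" "i \<noteq> j"
    show "E i \<inter> E j = {}"
    proof (rule ccontr)
      assume "E i \<inter> E j \<noteq> {}"
      then obtain e where e: "e \<in> E i" "e \<in> E j" by auto
      then obtain x where "x \<in> e" "x \<in> l1_ball (z i) (3 * m)" unfolding E_def by auto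
      moreover have "x \<in> l1_ball (z j) (3 * m)" using e(2) \<open>x \<in> e\<close> unfolding E_def by auto
      ultimately have "l1 (z i - z j) \<le> 6 * m"
        using l1_triangle_diff[of "z i" "z j" x] l1_minus_commute[of "z i" x] unfolding mem_l1_ball by linarith
      then show False using sep[OF ij] by simp
    qed
  qed
  have in_E: "{p ! i, p ! Suc i} \<in> E j" if "p \<in> crossings (z j) m m" "Suc i < length p" for p i j
  proof -
    have p: "p ! i \<noteq> p ! Suc i" "p ! i \<in> l1_ball (z j) (2 * m)" "l1 (p ! i - p ! Suc i) \<le> m"
      using that unfolding crossings_def lr_path_def by auto
    then have "p ! Suc i \<in> l1_ball (z j) (3 * m)"
      using l1_triangle_diff[of "p ! Suc i" "z j" "p ! i"] l1_minus_commute[of "p ! i" "p ! Suc i"]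
      unfolding mem_l1_ball by linarith
    moreover have "p ! i \<in> l1_ball (z j) (3 * m)" using p(2) unfolding mem_l1_ball by linarith
    ultimately show ?thesis using p(1) unfolding E_def by blast
  qed
  \<comment> \<open>The event has to be a measurable set of the weights on \<open>E j\<close> alone,
    because independence is available for the restrictions of the family to disjoint index
    sets.\<close>
  define Q where "Q j = {f\<in>space (PiM (E j) (\<lambda>_. borel :: real measure)).
    \<exists>p\<in>crossings (z j) m m. path_weight r f p \<le> \<tau>}" for j
  have Q: "Q j \<in> sets (PiM (E j) (\<lambda>_. borel))" for j
  proof -
    let ?N = "PiM (E j) (\<lambda>_. borel :: real measure)"
    have "Q j = (\<Union>p\<in>crossings (z j) m m. {f\<in>space ?N. path_weight r f p \<le> \<tau>})"
      unfolding Q_def by auto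
    also have "\<dots> \<in> sets ?N"
    proof (rule sets.countable_UN'')
      fix p assume p: "p \<in> crossings (z j) m m"
      have "(\<lambda>f. path_weight r f p) \<in> borel_measurable ?N"
        unfolding path_weight_def lr_W_def using in_E[OF p]
        by (intro borel_measurable_sum borel_measurable_divide measurable_component_singleton measurable_const) auto
      then show "{f\<in>space ?N. path_weight r f p \<le> \<tau>} \<in> sets ?N" by (intro borel_measurable_le) auto
    qed (auto intro: countable_subset[OF subset_UNIV])
    finally show ?thesis .
  qed
  let ?X = "\<lambda>j s. restrict (\<lambda>e. \<omega> e s) (E j)"
  have ind: "indep_vars (\<lambda>j. PiM (E j) (\<lambda>_. borel)) ?X J"
    by (rule indep_vars_restrict[OF indep Esub disj])
  have eq: "?X j -` Q j \<inter> space M = fast_event (z j) m \<tau>" for j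
  proof -
    have "path_weight r (?X j s) p = path_weight r (wt s) p" if "p \<in> crossings (z j) m m" for s p
      unfolding path_weight_def lr_W_def using in_E[OF that] by (intro sum.cong) auto
    then show ?thesis unfolding fast_event_def Q_def by (auto simp: space_PiM)
  qed
  have "space M \<inter> (\<Inter>j\<in>J. fast_event (z j) m \<tau>) = (\<Inter>j\<in>J. ?X j -` Q j \<inter> space M)"
    unfolding eq using False by (auto simp: fast_event_def)
  then have "prob (space M \<inter> (\<Inter>j\<in>J. fast_event (z j) m \<tau>)) = (\<Prod>j\<in>J. prob (?X j -` Q j \<inter> space M))"
    using indep_varsD[OF ind False J order_refl Q] by simp
  also have "\<dots> \<le> (\<Prod>j\<in>J. \<kappa>)" unfolding eq using \<kappa> by (intro prod_mono) auto
  finally show ?thesis by simp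
qed simp

section \<open>The lower bound\<close>

lemma edge_le_path_weight:
  assumes "s \<in> nonneg_event" "lr_path p" "Suc i < length p"
  shows "lr_W r (wt s) (p ! i) (p ! Suc i) \<le> path_weight r (wt s) p"
  unfolding path_weight_def using assms
  by (intro member_le_sum) (auto intro!: nonneg_W simp: lr_path_def)

text \<open>A jump longer than \<open>m\<close> starts at a vertex other than the last, hence inside
  the ball of radius \<open>2 * n\<close>, and its weight is at most that of the whole path.\<close>

lemma crossing_cases:
  assumes s: "s \<in> nonneg_event" and p: "p \<in> crossings c n l" "path_weight r (wt s) p \<le> t"
  shows "s \<in> long_edge_event c (2 * n) m t \<or> p \<in> crossings c n m"
proof (cases "\<forall>i. Suc i < length p \<longrightarrow> l1 (p ! i - p ! Suc i) \<le> m")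
  case True
  then show ?thesis using p unfolding crossings_def by auto
next
  case False
  then obtain i where i: "Suc i < length p" "m < l1 (p ! i - p ! Suc i)" by auto
  have "lr_path p" "p ! i \<in> l1_ball c (2 * n)" using p(1) i unfolding crossings_def by auto
  moreover have "p ! i \<noteq> p ! Suc i" using \<open>lr_path p\<close> i unfolding lr_path_def by auto
  moreover have "lr_W r (wt s) (p ! i) (p ! Suc i) \<le> t"
    using edge_le_path_weight[OF s \<open>lr_path p\<close> i(1)] p(2) by linarith
  moreover have "s \<in> space M" using s unfolding nonneg_event_def by auto
  ultimately have "s \<in> long_edge_event c (2 * n) m t"
    unfolding long_edge_event_def using i(2) by (auto intro!: exI[of _ "p ! Suc i"] bexI[of _ "p ! i"])
  then show ?thesis ..
qed

text \<open>A crossing has at least one edge, and its first edge is already cheap. This crude bound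
  starts the bootstrap.\<close>

lemma prob_fast_le_long:
  "prob (fast_event c n t) \<le> prob (long_edge_event c (2 * n) 1 t)"
proof -
  have "fast_event c n t \<inter> nonneg_event \<subseteq> long_edge_event c (2 * n) 1 t"
  proof
    fix s assume s: "s \<in> fast_event c n t \<inter> nonneg_event"
    then obtain p where p: "p \<in> crossings c n n" "path_weight r (wt s) p \<le> t"
      unfolding fast_event_def by auto
    have ne: "p \<noteq> []" and path: "lr_path p" using p(1) unfolding crossings_def lr_path_def by auto
    have "hd p \<noteq> last p" using p(1) unfolding crossings_def mem_l1_ball by auto
    then have "Suc 0 < length p" using ne by (cases p) (auto split: if_splits)
    then have "p ! 0 \<in> l1_ball c (2 * n)" "p ! 0 \<noteq> p ! Suc 0"
      using p(1) unfolding crossings_def lr_path_def by auto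
    moreover have "lr_W r (wt s) (p ! 0) (p ! Suc 0) \<le> t"
      using edge_le_path_weight[OF _ path \<open>Suc 0 < length p\<close>] s p(2) by fastforce
    ultimately show "s \<in> long_edge_event c (2 * n) 1 t"
      using s unfolding long_edge_event_def nonneg_event_def
      by (auto simp: Suc_le_eq intro!: bexI[of _ "p ! 0"] exI[of _ "p ! Suc 0"])
  qed
  then have "prob (fast_event c n t \<inter> nonneg_event) \<le> prob (long_edge_event c (2 * n) 1 t)"
    by (intro finite_measure_mono) auto
  then show ?thesis by (simp add: prob_Int_nonneg)
qed

text \<open>Union bound over codes \<open>(a, v, J)\<close>: at most
  \<open>(2 * n + 1) ^ CARD('d)\<close> starts, a constant number of choices for each of
  \<open>K\<close> increments, and \<open>2 ^ K\<close> sets \<open>J\<close>. Each code has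
  probability at most \<theta> to the power \<open>2 * card J\<close>, hence at most \<theta> to the
  power \<open>K\<close>; the square in the hypothesis compensates for only half of the blocks being
  fast.\<close>

lemma prob_fast_step:
  fixes c :: "int ^ 'd"
  assumes h: "h > 0" and m: "m = CARD('d) * h" and n: "(9 * K + 8) * m \<le> n"
    and t: "2 * t \<le> real K * \<tau>" and \<tau>: "0 < \<tau>" and K: "0 < K"
    and \<theta>: "0 \<le> \<theta>" "\<theta> \<le> 1" "\<And>z. prob (fast_event z m \<tau>) \<le> \<theta>\<^sup>2"
  shows "prob (fast_event c n t) \<le> prob (long_edge_event c (2 * n) m t) +
    real (2 * n + 1) ^ CARD('d) * (2 * real ((2 * (9 * CARD('d)) + 1) ^ CARD('d)) * \<theta>) ^ K"
proof -
  let ?A = "block h ` l1_ball c n"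
  let ?S = "block_steps h (9 * CARD('d)) :: (int ^ 'd) set"
  let ?V = "PiE {..<K} (\<lambda>_. ?S)"
  let ?D = "(2 * (9 * CARD('d)) + 1) ^ CARD('d)"
  define I where "I = {(a, v, J) \<in> ?A \<times> ?V \<times> Pow {..<K}. K \<le> 2 * card J \<and>
      (\<forall>i\<in>J. \<forall>j\<in>J. i \<noteq> j \<longrightarrow> 6 * m < l1 (chain a v i - chain a v j))}"
  define F where "F = (\<lambda>(a, v, J). space M \<inter> (\<Inter>j\<in>J. fast_event (chain a v j) m \<tau>))"
  have finV: "finite ?V" by (intro finite_PiE) auto
  have I_sub: "I \<subseteq> ?A \<times> ?V \<times> Pow {..<K}" unfolding I_def by auto
  have fin: "finite (?A \<times> ?V \<times> Pow {..<K})" using finV by simp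
  have finI: "finite I" by (rule finite_subset[OF I_sub fin])
  have F_ev: "F i \<in> events" if "i \<in> I" for i
  proof -
    obtain a v J where i: "i = (a, v, J)" by (cases i)
    have "finite J" using that unfolding I_def i by (auto intro: finite_subset)
    then show ?thesis unfolding F_def i prod.case
      by (cases "J = {}") (auto intro!: sets.Int sets.finite_INT)
  qed
  have pF: "prob (F i) \<le> \<theta> ^ K" if "i \<in> I" for i
  proof -
    obtain a v J where i: "i = (a, v, J)" by (cases i)
    have J: "finite J" "K \<le> 2 * card J" using that unfolding I_def i by (auto intro: finite_subset)
    have "prob (F i) \<le> (\<theta>\<^sup>2) ^ card J"
      unfolding F_def i prod.case using that J \<theta>(3)
      by (intro prob_fast_Int_le) (auto simp: I_def i)
    also have "\<dots> = \<theta> ^ (2 * card J)" by (simp add: power_mult)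
    also have "\<dots> \<le> \<theta> ^ K" using \<theta> J by (intro power_decreasing) auto
    finally show ?thesis .
  qed
  have "fast_event c n t \<inter> nonneg_event \<subseteq> long_edge_event c (2 * n) m t \<union> (\<Union>i\<in>I. F i)"
  proof
    fix s assume s: "s \<in> fast_event c n t \<inter> nonneg_event"
    then obtain p where p: "p \<in> crossings c n n" "path_weight r (wt s) p \<le> t"
      unfolding fast_event_def by auto
    show "s \<in> long_edge_event c (2 * n) m t \<union> (\<Union>i\<in>I. F i)"
    proof (cases "s \<in> long_edge_event c (2 * n) m t")
      case False
      then have p': "p \<in> crossings c n m" using crossing_cases[OF _ p] s by blast
      obtain a v J where avJ: "a \<in> ?A" "v \<in> ?V" "J \<in> Pow {..<K}" "K \<le> 2 * card J"
        "\<forall>i\<in>J. \<forall>j\<in>J. i \<noteq> j \<longrightarrow> 6 * m < l1 (chain a v i - chain a v j)"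
        "\<forall>j\<in>J. \<exists>p\<in>crossings (chain a v j) m m. path_weight r (wt s) p \<le> \<tau>"
        using crossing_imp_fast_blocks[OF h m nonneg_W p' n p(2) t \<tau> K] s by blast
      have "(a, v, J) \<in> I" using avJ unfolding I_def by auto
      moreover have "s \<in> F (a, v, J)" using avJ(6) s unfolding F_def fast_event_def by auto
      ultimately show ?thesis by blast
    qed simp
  qed
  then have "prob (fast_event c n t \<inter> nonneg_event) \<le> prob (long_edge_event c (2 * n) m t \<union> (\<Union>i\<in>I. F i))"
    using finI F_ev by (intro finite_measure_mono sets.Un sets.finite_UN) auto
  also have "\<dots> \<le> prob (long_edge_event c (2 * n) m t) + prob (\<Union>i\<in>I. F i)"
    using finI F_ev by (intro measure_Un_le sets.finite_UN) auto
  also have "prob (\<Union>i\<in>I. F i) \<le> (\<Sum>i\<in>I. prob (F i))"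
    using finI F_ev by (intro finite_measure_subadditive_finite) auto
  also have "\<dots> \<le> (\<Sum>i\<in>I. \<theta> ^ K)" by (intro sum_mono pF)
  also have "\<dots> = real (card I) * \<theta> ^ K" by simp
  also have "\<dots> \<le> real ((2 * n + 1) ^ CARD('d) * (?D ^ K * 2 ^ K)) * \<theta> ^ K"
  proof (intro mult_right_mono of_nat_mono)
    have "card I \<le> card (?A \<times> ?V \<times> Pow {..<K})" by (rule card_mono[OF fin I_sub])
    also have "\<dots> = card ?A * (card ?S ^ K * 2 ^ K)"
      by (simp add: card_cartesian_product card_PiE card_Pow)
    also have "\<dots> \<le> (2 * n + 1) ^ CARD('d) * (?D ^ K * 2 ^ K)"
      by (intro mult_mono power_mono card_block_steps_le
          order_trans[OF card_image_le[OF finite_l1_ball] card_l1_ball_le]) auto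
    finally show "card I \<le> (2 * n + 1) ^ CARD('d) * (?D ^ K * 2 ^ K)" .
  qed (use \<theta> in auto)
  also have "\<dots> = real (2 * n + 1) ^ CARD('d) * (2 * real ?D * \<theta>) ^ K"
    by (simp add: power_mult_distrib mult_ac)
  finally show ?thesis by (simp add: prob_Int_nonneg)
qed

text \<open>With radius of order \<open>H\<close>, time \<open>H powr \<beta>\<close> and length of
  order \<open>H powr (1 - \<delta>)\<close>, the first-moment bound is a constant times
  \<open>H\<close> to the exponent in \<open>ex\<close>. A lower bound on \<open>h\<close> is
  enough, since the length enters with a negative exponent. The case \<open>\<delta> = 0\<close>
  serves the exit estimate.\<close>

lemma eventually_long_edge_le:
  assumes \<gamma>: "real CARD('d) < \<gamma>" "\<gamma> < \<alpha>"
    and ex: "real CARD('d) + \<beta> + (1 - \<delta>) * (real CARD('d) - \<gamma>) < 0" and \<kappa>: "0 < \<kappa>"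
  shows "eventually (\<lambda>H. \<forall>h c. real H powr (1 - \<delta>) / 2 \<le> real h \<longrightarrow>
    prob (long_edge_event c (2 * (CARD('d) * H)) (CARD('d) * h) (real H powr \<beta>)) \<le> \<kappa>) sequentially"
proof -
  let ?d = "real CARD('d)"
  obtain C where C: "C > 0" "\<And>c R m \<tau>. 1 \<le> m \<Longrightarrow> 0 \<le> \<tau> \<Longrightarrow>
    prob (long_edge_event c R m \<tau>) \<le> C * real (2 * R + 1) ^ CARD('d) * \<tau> * real m powr (?d - \<gamma>)"
    using prob_long_edge_le[OF \<gamma>] by blast
  define B where "B = C * (5 * ?d) ^ CARD('d) * (1 / 2) powr (?d - \<gamma>)"
  define e where "e = ?d + \<beta> + (1 - \<delta>) * (?d - \<gamma>)"
  have "((\<lambda>H. B * H powr e) \<longlongrightarrow> B * 0) at_top"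
    using ex unfolding e_def by (intro tendsto_mult tendsto_const tendsto_neg_powr filterlim_ident)
  then have "((\<lambda>H. B * real H powr e) \<longlongrightarrow> B * 0) sequentially"
    by (rule filterlim_compose[OF _ filterlim_real_sequentially])
  then have "eventually (\<lambda>H. B * real H powr e < \<kappa>) sequentially"
    using \<kappa> by (intro order_tendstoD) auto
  then show ?thesis
    using eventually_ge_at_top[of 1]
  proof eventually_elim
    case (elim H)
    show ?case
    proof (intro allI impI)
      fix h c assume hH: "real H powr (1 - \<delta>) / 2 \<le> real h"
      have Hp: "0 < real H powr (1 - \<delta>)" using elim by simp
      have "0 < h" using hH Hp by (cases h) auto
      then have m1: "1 \<le> CARD('d) * h" using d_ge_1 by (simp add: Suc_le_eq)
      have "real h \<le> real (CARD('d) * h)" using d_ge_1 by (intro of_nat_mono) simp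
      then have mh: "real H powr (1 - \<delta>) * (1 / 2) \<le> real (CARD('d) * h)" using hH by linarith
      have "2 * (2 * (CARD('d) * H)) + 1 \<le> 5 * CARD('d) * H"
        using elim m1 d_ge_1 by (simp add: Suc_le_eq)
      then have "real (2 * (2 * (CARD('d) * H)) + 1) \<le> real (5 * CARD('d) * H)" by (rule of_nat_mono)
      then have R: "real (2 * (2 * (CARD('d) * H)) + 1) ^ CARD('d) \<le> (5 * ?d * real H) ^ CARD('d)"
        by (intro power_mono) simp_all
      have P: "real (CARD('d) * h) powr (?d - \<gamma>) \<le> (real H powr (1 - \<delta>) * (1 / 2)) powr (?d - \<gamma>)"
        using mh \<gamma> Hp by (intro powr_mono2') auto
      have "prob (long_edge_event c (2 * (CARD('d) * H)) (CARD('d) * h) (real H powr \<beta>))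
          \<le> C * real (2 * (2 * (CARD('d) * H)) + 1) ^ CARD('d) * real H powr \<beta> * real (CARD('d) * h) powr (?d - \<gamma>)"
        by (rule C(2)[OF m1]) simp
      also have "\<dots> \<le> C * (5 * ?d * real H) ^ CARD('d) * real H powr \<beta> * (real H powr (1 - \<delta>) * (1 / 2)) powr (?d - \<gamma>)"
        using C(1) by (intro mult_mono R P order_refl) auto
      also have "\<dots> = B * (real H ^ CARD('d) * real H powr \<beta> * real H powr ((1 - \<delta>) * (?d - \<gamma>)))"
        unfolding B_def using elim by (subst powr_mult) (auto simp: powr_powr power_mult_distrib mult_ac)
      also have "\<dots> = B * real H powr e"
        unfolding e_def using elim by (simp add: powr_add powr_realpow)
      finally show "prob (long_edge_event c (2 * (CARD('d) * H)) (CARD('d) * h) (real H powr \<beta>)) \<le> \<kappa>"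
        using elim by linarith
    qed
  qed
qed

text \<open>Radii are multiples of \<open>CARD('d)\<close> because blocks of side \<open>h\<close>
  have l1 radius up to \<open>CARD('d) * h\<close>; this keeps the family of scales closed under the
  induction. Uniformity in \<open>c\<close> lets the bound apply to every block of a chain.\<close>

definition slow_at :: "real \<Rightarrow> bool" where
  "slow_at \<beta> \<longleftrightarrow> (\<forall>\<kappa>>0. \<exists>h0. \<forall>h\<ge>h0. \<forall>c. prob (fast_event c (CARD('d) * h) (real h powr \<beta>)) \<le> \<kappa>)"

text \<open>Order \<open>h ^ d\<close> sites, with d the dimension, each meet edges of bounded total
  rate; in time \<open>h powr (- d - 1)\<close> a cheap edge has probability of order
  \<open>1 / h\<close>. The exponent \<open>2 * d\<close> for the rates is a convenient value
  between d and \<alpha>.\<close>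

lemma slow_at_base: "slow_at (- real CARD('d) - 1)"
  unfolding slow_at_def
proof (intro allI impI)
  fix \<kappa> :: real assume \<kappa>: "0 < \<kappa>"
  let ?d = "real CARD('d)"
  have \<gamma>: "?d < 2 * ?d" "2 * ?d < \<alpha>" using \<alpha>_gt by auto
  obtain C where C: "C > 0" "\<And>c R m \<tau>. 1 \<le> m \<Longrightarrow> 0 \<le> \<tau> \<Longrightarrow>
    prob (long_edge_event c R m \<tau>) \<le> C * real (2 * R + 1) ^ CARD('d) * \<tau> * real m powr (?d - 2 * ?d)"
    using prob_long_edge_le[OF \<gamma>] by blast
  define B where "B = C * (5 * ?d) ^ CARD('d)"
  have "B > 0" unfolding B_def using C(1) by simp
  have "prob (fast_event c (CARD('d) * h) (real h powr (- ?d - 1))) \<le> \<kappa>"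
    if h: "nat \<lceil>B / \<kappa>\<rceil> + 1 \<le> h" for h c
  proof -
    have h1: "1 \<le> h" "B / \<kappa> \<le> real h" using h by linarith+
    have "1 \<le> CARD('d) * h" using h1 d_ge_1 by (simp add: Suc_le_eq)
    then have "2 * (2 * (CARD('d) * h)) + 1 \<le> 5 * CARD('d) * h" by simp
    then have "real (2 * (2 * (CARD('d) * h)) + 1) \<le> real (5 * CARD('d) * h)" by (rule of_nat_mono)
    then have R: "real (2 * (2 * (CARD('d) * h)) + 1) \<le> 5 * ?d * real h" by simp
    have "prob (fast_event c (CARD('d) * h) (real h powr (- ?d - 1)))
        \<le> C * real (2 * (2 * (CARD('d) * h)) + 1) ^ CARD('d) * real h powr (- ?d - 1) * real 1 powr (?d - 2 * ?d)"
      by (rule order_trans[OF prob_fast_le_long C(2)]) auto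
    also have "\<dots> \<le> C * (5 * ?d * real h) ^ CARD('d) * real h powr (- ?d - 1) * 1"
      using C(1) R by (intro mult_mono power_mono) auto
    also have "\<dots> = B * (real h powr ?d * real h powr (- ?d - 1))"
      unfolding B_def using h1 by (simp add: power_mult_distrib powr_realpow)
    also have "real h powr ?d * real h powr (- ?d - 1) = real h powr (- 1)"
      by (simp add: powr_add[symmetric])
    also have "B * real h powr (- 1) \<le> \<kappa>" using h1 \<kappa> by (simp add: powr_minus field_simps)
    finally show ?thesis .
  qed
  then show "\<exists>h0. \<forall>h\<ge>h0. \<forall>c. prob (fast_event c (CARD('d) * h) (real h powr (- ?d - 1))) \<le> \<kappa>"
    by blast
qed

text \<open>With \<open>h\<close> near \<open>H powr (1 - \<delta>)\<close> and \<open>K\<close> of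
  order \<open>H / h\<close>, slow blocks cost about \<open>K * h powr \<beta>'\<close>, that is
  \<open>H\<close> to the power \<open>\<beta>' + \<delta> * (1 - \<beta>')\<close>. The condition
  \<open>ex\<close> excludes edges longer than the blocks.\<close>

lemma slow_at_step:
  assumes slow: "slow_at \<beta>'" and \<gamma>: "real CARD('d) < \<gamma>" "\<gamma> < \<alpha>" and \<delta>: "0 < \<delta>" "\<delta> < 1"
    and ex: "real CARD('d) + \<beta> + (1 - \<delta>) * (real CARD('d) - \<gamma>) < 0"
    and \<beta>: "\<beta> < \<beta>' + \<delta> * (1 - \<beta>')"
  shows "slow_at \<beta>"
  unfolding slow_at_def
proof (intro allI impI)
  fix \<kappa> :: real assume \<kappa>: "0 < \<kappa>"
  let ?d = "real CARD('d)"
  define D where "D = real ((2 * (9 * CARD('d)) + 1) ^ CARD('d))"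
  have "D \<ge> 1" unfolding D_def by (metis of_nat_1 of_nat_le_iff one_le_power le_add2)
  \<comment> \<open>Makes \<open>2 * D * \<theta>\<close> equal to one half: the union bound is then
    a power of \<open>H\<close> times \<open>2 powr (- K)\<close>, which vanishes since
    \<open>K\<close> grows like \<open>H powr \<delta>\<close>.\<close>
  define \<theta> where "\<theta> = 1 / (4 * D)"
  have \<theta>: "0 < \<theta>" "\<theta> \<le> 1" "2 * D * \<theta> = 1 / 2" using \<open>D \<ge> 1\<close> unfolding \<theta>_def by (auto simp: field_simps)
  obtain h0 where h0: "\<And>h c. h0 \<le> h \<Longrightarrow> prob (fast_event c (CARD('d) * h) (real h powr \<beta>')) \<le> \<theta>\<^sup>2"
    using slow \<theta>(1) unfolding slow_at_def by (meson zero_less_power)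
  \<comment> \<open>The 40 is from the lower bound on \<open>K\<close>; the power of 2 covers
    replacing \<open>h\<close> by half of \<open>H powr (1 - \<delta>)\<close>.\<close>
  define c0 where "c0 = 2 powr (- \<bar>\<beta>'\<bar>) / 40"
  have c0: "0 < c0" unfolding c0_def by simp
  have e1: "\<forall>\<^sub>F H in at_top. 2 * real h0 + 2 \<le> H powr (1 - \<delta>)" using \<delta> by real_asymp
  have e2: "\<forall>\<^sub>F H in at_top. 40 \<le> H powr \<delta>" using \<delta> by real_asymp
  have e3: "\<forall>\<^sub>F H in at_top. 8 * H powr (1 - \<delta>) \<le> H / 2" using \<delta> by real_asymp
  have e4: "\<forall>\<^sub>F H in at_top. 2 * H powr \<beta> \<le> c0 * H powr (\<beta>' + \<delta> * (1 - \<beta>'))"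
  proof -
    define g where "g = \<beta>' + \<delta> * (1 - \<beta>') - \<beta>"
    have g: "0 < g" using \<beta> unfolding g_def by simp
    have "\<forall>\<^sub>F H in at_top. 2 \<le> c0 * H powr g" using c0 g by real_asymp
    then show ?thesis using eventually_gt_at_top[of 0]
    proof eventually_elim
      case (elim H)
      have "2 * H powr \<beta> \<le> (c0 * H powr g) * H powr \<beta>" using elim by (intro mult_right_mono) auto
      then show ?case by (simp add: mult.assoc powr_add[symmetric] g_def)
    qed
  qed
  have e5: "\<forall>\<^sub>F H in at_top. (2 * ?d * H + 1) ^ CARD('d) * 2 powr (- (H powr \<delta> / 40)) \<le> \<kappa> / 2"
  proof -
    have "((\<lambda>H. (3 * ?d * H) powr ?d * 2 powr (- (H powr \<delta> / 40))) \<longlongrightarrow> 0) at_top"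
      using \<delta> d_ge_1 by real_asymp
    then have "\<forall>\<^sub>F H in at_top. (3 * ?d * H) powr ?d * 2 powr (- (H powr \<delta> / 40)) < \<kappa> / 2"
      using \<kappa> by (intro order_tendstoD) auto
    then show ?thesis using eventually_ge_at_top[of 1]
    proof eventually_elim
      case (elim H)
      have "1 * 1 \<le> ?d * H" using elim d_ge_1 by (intro mult_mono) auto
      then have "2 * ?d * H + 1 \<le> 3 * ?d * H" by linarith
      then have "(2 * ?d * H + 1) ^ CARD('d) \<le> (3 * ?d * H) ^ CARD('d)"
        using elim by (intro power_mono) auto
      also have "\<dots> = (3 * ?d * H) powr ?d" using elim by (simp add: powr_realpow)
      finally have "(2 * ?d * H + 1) ^ CARD('d) * 2 powr (- (H powr \<delta> / 40))
          \<le> (3 * ?d * H) powr ?d * 2 powr (- (H powr \<delta> / 40))" by (intro mult_right_mono) auto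
      then show ?case using elim by linarith
    qed
  qed
  note ev = e1[THEN eventually_compose_filterlim, OF filterlim_real_sequentially]
    e2[THEN eventually_compose_filterlim, OF filterlim_real_sequentially]
    e3[THEN eventually_compose_filterlim, OF filterlim_real_sequentially]
    e4[THEN eventually_compose_filterlim, OF filterlim_real_sequentially]
    e5[THEN eventually_compose_filterlim, OF filterlim_real_sequentially]
  have "0 < \<kappa> / 2" using \<kappa> by simp
  note lg = eventually_long_edge_le[OF \<gamma> ex this]
  have "eventually (\<lambda>H. \<forall>c. prob (fast_event c (CARD('d) * H) (real H powr \<beta>)) \<le> \<kappa>) sequentially"
    using ev lg eventually_ge_at_top[of 1]
  proof eventually_elim
    case (elim H)
    define h where "h = nat \<lfloor>real H powr (1 - \<delta>)\<rfloor>"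
    \<comment> \<open>With 20 in the denominator, \<open>9 * K * h\<close> is at most
      \<open>9 * H / 20\<close>; together with \<open>8 * h\<close>, at most \<open>H / 2\<close>,
      the required length still fits into \<open>H\<close>.\<close>
    define K where "K = nat \<lfloor>real H powr \<delta> / 20\<rfloor>"
    have H1: "1 \<le> real H" using elim by simp
    have h_up: "real h \<le> real H powr (1 - \<delta>)" unfolding h_def by (rule of_nat_floor) simp
    have h_lo: "real H powr (1 - \<delta>) - 1 \<le> real h" unfolding h_def by linarith
    have h_half: "real H powr (1 - \<delta>) / 2 \<le> real h" and hh0: "h0 \<le> h" and hpos: "0 < h"
      using h_lo elim(1) by linarith+
    have K_up: "real K \<le> real H powr \<delta> / 20" unfolding K_def by (rule of_nat_floor) simp
    have K_lo: "real H powr \<delta> / 20 - 1 \<le> real K" unfolding K_def by linarith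
    have K_half: "real H powr \<delta> / 40 \<le> real K" and Kpos: "0 < K"
      using K_lo elim(2) by linarith+
    have split: "real H powr \<delta> * real H powr (1 - \<delta>) = real H" using H1 by (simp add: powr_add[symmetric])
    have "real ((9 * K + 8) * h) = 9 * (real K * real h) + 8 * real h" by (simp add: algebra_simps)
    also have "real K * real h \<le> real H powr \<delta> / 20 * real H powr (1 - \<delta>)"
      using K_up h_up by (intro mult_mono) auto
    also have "\<dots> = real H / 20" using split by simp
    finally have "real ((9 * K + 8) * h) \<le> real H" using h_up elim(3) by linarith
    then have nK: "(9 * K + 8) * h \<le> H" by linarith
    have n: "(9 * K + 8) * (CARD('d) * h) \<le> CARD('d) * H"
      using mult_left_mono[OF nK, of "CARD('d)"] by (simp add: mult_ac)
    \<comment> \<open>The sign of \<open>\<beta>'\<close> decides which rounding bound on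
      \<open>h\<close> matters: the lower one if nonnegative, the upper one if negative.\<close>
    have hb: "2 powr (- \<bar>\<beta>'\<bar>) * real H powr ((1 - \<delta>) * \<beta>') \<le> real h powr \<beta>'"
    proof (cases "0 \<le> \<beta>'")
      case True
      have "2 powr (- \<bar>\<beta>'\<bar>) * real H powr ((1 - \<delta>) * \<beta>') = (real H powr (1 - \<delta>) / 2) powr \<beta>'"
        using True by (simp add: powr_divide powr_powr powr_minus field_simps)
      also have "\<dots> \<le> real h powr \<beta>'" using h_half True by (intro powr_mono2) auto
      finally show ?thesis .
    next
      case False
      have "2 powr (- \<bar>\<beta>'\<bar>) * real H powr ((1 - \<delta>) * \<beta>') \<le> 2 powr 0 * real H powr ((1 - \<delta>) * \<beta>')"
        by (intro mult_right_mono powr_mono) auto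
      also have "\<dots> = (real H powr (1 - \<delta>)) powr \<beta>'" by (simp add: powr_powr)
      also have "\<dots> \<le> real h powr \<beta>'" using False h_up hpos by (intro powr_mono2') auto
      finally show ?thesis .
    qed
    have "c0 * real H powr (\<beta>' + \<delta> * (1 - \<beta>')) =
        (real H powr \<delta> / 40) * (2 powr (- \<bar>\<beta>'\<bar>) * real H powr ((1 - \<delta>) * \<beta>'))"
    proof -
      have "\<beta>' + \<delta> * (1 - \<beta>') = \<delta> + (1 - \<delta>) * \<beta>'" by (simp add: algebra_simps)
      then show ?thesis unfolding c0_def by (simp add: powr_add)
    qed
    also have "\<dots> \<le> real K * real h powr \<beta>'" using K_half hb by (intro mult_mono) auto
    finally have t: "2 * real H powr \<beta> \<le> real K * real h powr \<beta>'" using elim(4) by linarith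
    show ?case
    proof
      fix c :: "int ^ 'd"
      have "prob (fast_event c (CARD('d) * H) (real H powr \<beta>))
          \<le> prob (long_edge_event c (2 * (CARD('d) * H)) (CARD('d) * h) (real H powr \<beta>)) +
            real (2 * (CARD('d) * H) + 1) ^ CARD('d) * (2 * D * \<theta>) ^ K"
        unfolding D_def using hpos Kpos \<theta> h0[OF hh0]
        by (intro prob_fast_step[OF hpos refl n t]) auto
      also have "prob (long_edge_event c (2 * (CARD('d) * H)) (CARD('d) * h) (real H powr \<beta>)) \<le> \<kappa> / 2"
        using elim(6) h_half by blast
      also have "real (2 * (CARD('d) * H) + 1) ^ CARD('d) * (2 * D * \<theta>) ^ K
          \<le> (2 * ?d * real H + 1) ^ CARD('d) * 2 powr (- (real H powr \<delta> / 40))"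
      proof (intro mult_mono)
        have "(2 * D * \<theta>) ^ K = 2 powr (- real K)"
          unfolding \<theta>(3) by (simp add: powr_minus powr_realpow power_one_over inverse_eq_divide)
        also have "\<dots> \<le> 2 powr (- (real H powr \<delta> / 40))" using K_half by (intro powr_mono) auto
        finally show "(2 * D * \<theta>) ^ K \<le> 2 powr (- (real H powr \<delta> / 40))" .
      qed (use \<theta> in \<open>auto simp: mult_ac\<close>)
      also have "\<dots> \<le> \<kappa> / 2" by (rule elim(5))
      finally show "prob (fast_event c (CARD('d) * H) (real H powr \<beta>)) \<le> \<kappa>" by simp
    qed
  qed
  then show "\<exists>h0. \<forall>h\<ge>h0. \<forall>c. prob (fast_event c (CARD('d) * h) (real h powr \<beta>)) \<le> \<kappa>"
    unfolding eventually_sequentially .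
qed

lemma slow_at_mono:
  assumes "slow_at \<beta>'" "\<beta> \<le> \<beta>'"
  shows "slow_at \<beta>"
  unfolding slow_at_def
proof (intro allI impI)
  fix \<kappa> :: real assume "0 < \<kappa>"
  then obtain h0 where h0: "\<And>h c. h0 \<le> h \<Longrightarrow> prob (fast_event c (CARD('d) * h) (real h powr \<beta>')) \<le> \<kappa>"
    using assms(1) unfolding slow_at_def by blast
  have "prob (fast_event c (CARD('d) * h) (real h powr \<beta>)) \<le> \<kappa>" if "max 1 h0 \<le> h" for h c
  proof -
    have le: "real h powr \<beta> \<le> real h powr \<beta>'" using that assms(2) by (intro powr_mono) auto
    have "prob (fast_event c (CARD('d) * h) (real h powr \<beta>)) \<le> prob (fast_event c (CARD('d) * h) (real h powr \<beta>'))"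
    proof (rule finite_measure_mono[OF _ sets_fast_event])
      show "fast_event c (CARD('d) * h) (real h powr \<beta>) \<subseteq> fast_event c (CARD('d) * h) (real h powr \<beta>')"
        unfolding fast_event_def using le by (auto intro: order_trans)
    qed
    then show ?thesis using h0[of h c] that by simp
  qed
  then show "\<exists>h0. \<forall>h\<ge>h0. \<forall>c. prob (fast_event c (CARD('d) * h) (real h powr \<beta>)) \<le> \<kappa>" by blast
qed

text \<open>Iterates the step with one fixed \<delta> up to the cap \<open>b\<close>. Exponents stay
  below \<open>\<eta> < 1\<close>, so every step gains at least the fixed amount
  \<open>\<sigma>\<close> until the cap is reached.\<close>

lemma slow_at:
  assumes \<beta>: "\<beta> < \<alpha> - 2 * real CARD('d)"
  shows "slow_at \<beta>"
proof -
  let ?d = "real CARD('d)"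
  define \<eta> where "\<eta> = \<alpha> - 2 * ?d"
  have \<eta>: "0 < \<eta>" "\<eta> < 1" using \<alpha>_gt \<alpha>_less unfolding \<eta>_def by auto
  \<comment> \<open>The minimum with \<open>\<eta>\<close> keeps \<open>b\<close> nonnegative, hence
    above the base exponent, and keeps \<open>\<gamma>\<close> above the dimension.\<close>
  define \<epsilon> where "\<epsilon> = min \<eta> (\<eta> - \<beta>)"
  have \<epsilon>: "0 < \<epsilon>" "\<epsilon> \<le> \<eta>" "\<beta> \<le> \<eta> - \<epsilon>" using \<beta> \<eta> unfolding \<epsilon>_def \<eta>_def by auto
  define b where "b = \<eta> - \<epsilon>"
  define \<gamma> where "\<gamma> = \<alpha> - \<epsilon> / 2"
  have "?d < \<alpha> - \<eta>" unfolding \<eta>_def by simp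
  then have \<gamma>: "?d < \<gamma>" "\<gamma> < \<alpha>" using \<epsilon> unfolding \<gamma>_def by auto
  \<comment> \<open>Shortening the edges from \<open>H\<close> to
    \<open>H powr (1 - \<delta>)\<close> then costs at most \<open>\<epsilon> / 4\<close> in the
    exponent, which leaves at most \<open>- \<epsilon> / 4\<close> in \<open>ex\<close>.\<close>
  define \<delta> where "\<delta> = min (1 / 2) (\<epsilon> / (4 * \<alpha>))"
  have "0 < \<alpha>" using \<gamma> by (smt (verit) of_nat_0_le_iff)
  then have \<delta>: "0 < \<delta>" "\<delta> < 1" unfolding \<delta>_def using \<epsilon> by auto
  have "\<delta> * (\<gamma> - ?d) \<le> \<epsilon> / (4 * \<alpha>) * \<alpha>"
    using \<gamma> \<epsilon> \<open>0 < \<alpha>\<close> by (intro mult_mono) (auto simp: \<delta>_def)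
  then have "\<delta> * (\<gamma> - ?d) \<le> \<epsilon> / 4" using \<open>0 < \<alpha>\<close> by simp
  then have ex: "?d + \<beta>' + (1 - \<delta>) * (?d - \<gamma>) < 0" if "\<beta>' \<le> b" for \<beta>'
  proof -
    have "?d + \<beta>' + (1 - \<delta>) * (?d - \<gamma>) = 2 * ?d + \<beta>' - \<gamma> + \<delta> * (\<gamma> - ?d)"
      by (simp add: algebra_simps)
    also have "\<dots> \<le> 2 * ?d + b - \<gamma> + \<epsilon> / 4"
      using that \<open>\<delta> * (\<gamma> - ?d) \<le> \<epsilon> / 4\<close> by linarith
    also have "\<dots> < 0" using \<epsilon>(1) unfolding b_def \<gamma>_def \<eta>_def by linarith
    finally show ?thesis .
  qed
  \<comment> \<open>Half of the guaranteed gain, because the step only reaches exponents strictly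
    below its limit.\<close>
  define \<sigma> where "\<sigma> = \<delta> * (1 - \<eta>) / 2"
  have \<sigma>: "0 < \<sigma>" unfolding \<sigma>_def using \<delta> \<eta> by simp
  have "slow_at (min b (- ?d - 1 + real k * \<sigma>))" for k
  proof (induction k)
    case 0
    have "min b (- ?d - 1) = - ?d - 1" using \<epsilon> unfolding b_def by simp
    then show ?case using slow_at_base by simp
  next
    case (Suc k)
    let ?b' = "min b (- ?d - 1 + real k * \<sigma>)" and ?b = "min b (- ?d - 1 + real (Suc k) * \<sigma>)"
    have "\<sigma> < \<delta> * (1 - \<eta>)" unfolding \<sigma>_def using \<delta> \<eta> by simp
    also have "\<dots> \<le> \<delta> * (1 - ?b')" using \<delta> \<epsilon> unfolding b_def by (intro mult_left_mono) auto
    finally have "\<sigma> < \<delta> * (1 - ?b')" .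
    moreover have "?b \<le> ?b' + \<sigma>" using \<sigma> by (auto simp: min_def algebra_simps)
    ultimately have "?b < ?b' + \<delta> * (1 - ?b')" by linarith
    then show ?case using slow_at_step[OF Suc \<gamma> \<delta> ex] by simp
  qed
  moreover obtain k where "(b + ?d + 1) / \<sigma> \<le> real k" using real_arch_simple by blast
  then have "b \<le> - ?d - 1 + real k * \<sigma>" using \<sigma> by (simp add: field_simps)
  ultimately have "slow_at b" by (metis min.absorb1)
  then show ?thesis using \<epsilon>(3) unfolding b_def by (rule slow_at_mono)
qed

definition exit_event :: "nat \<Rightarrow> real \<Rightarrow> 'a set" where
  "exit_event n t = {s\<in>space M. \<exists>p\<in>{p. lr_path p \<and> hd p = 0 \<and> last p \<notin> l1_ball 0 (2 * n)}.
    path_weight r (wt s) p \<le> t}"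

lemma sets_exit_event [measurable]: "exit_event n t \<in> events"
  unfolding exit_event_def by (rule sets_ex_path) auto

text \<open>Truncating the path at its first exit gives a crossing with some finite jump bound; a
  jump longer than \<open>n\<close> is then a cheap long edge.\<close>

lemma prob_exit_le:
  "prob (exit_event n t) \<le> prob (long_edge_event 0 (2 * n) n t) + prob (fast_event 0 n t)"
proof -
  have "exit_event n t \<inter> nonneg_event \<subseteq> long_edge_event 0 (2 * n) n t \<union> fast_event 0 n t"
  proof
    fix s assume s: "s \<in> exit_event n t \<inter> nonneg_event"
    then obtain p where p: "lr_path p" "hd p = 0" "last p \<notin> l1_ball 0 (2 * n)" "path_weight r (wt s) p \<le> t"
      unfolding exit_event_def by auto
    define N where "N = length p - 1"
    have len: "length p = Suc N" using p(1) unfolding N_def lr_path_def by simp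
    \<comment> \<open>Any finite bound on the jumps serves; \<open>crossing_cases\<close> lowers it
      to \<open>n\<close>.\<close>
    define l where "l = (\<Sum>i<N. l1 (p ! i - p ! Suc i))"
    have step: "p ! i \<noteq> p ! Suc i \<and> l1 (p ! i - p ! Suc i) \<le> l" if "i < N" for i
      using that p(1) len unfolding l_def lr_path_def by (auto intro!: member_le_sum)
    have "\<exists>e. 0 \<le> e \<and> e \<le> N \<and> map ((!) p) [0..<Suc e] \<in> crossings 0 n l"
      using p step len by (intro first_crossing) (auto simp: mem_l1_ball hd_conv_nth last_conv_nth lr_path_def)
    then obtain e where e: "e \<le> N" "map ((!) p) [0..<Suc e] \<in> crossings 0 n l" by blast
    let ?q = "map ((!) p) [0..<Suc e]"
    have "path_weight r (wt s) ?q = (\<Sum>i\<in>{0..<e}. lr_W r (wt s) (p ! i) (p ! Suc i))"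
      by (rule path_weight_map_upt) simp
    also have "\<dots> \<le> path_weight r (wt s) p"
      unfolding path_weight_def N_def[symmetric] using e(1) s step
      by (intro sum_mono2) (auto intro!: nonneg_W)
    finally have w: "path_weight r (wt s) ?q \<le> t" using p(4) by linarith
    have "s \<in> long_edge_event 0 (2 * n) n t \<or> ?q \<in> crossings 0 n n"
      using s by (intro crossing_cases[OF _ e(2) w]) auto
    then show "s \<in> long_edge_event 0 (2 * n) n t \<union> fast_event 0 n t"
      using s w unfolding fast_event_def nonneg_event_def by blast
  qed
  then have "prob (exit_event n t \<inter> nonneg_event) \<le> prob (long_edge_event 0 (2 * n) n t \<union> fast_event 0 n t)"
    by (intro finite_measure_mono) auto
  also have "\<dots> \<le> prob (long_edge_event 0 (2 * n) n t) + prob (fast_event 0 n t)"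
    by (intro measure_Un_le) auto
  finally show ?thesis by (simp add: prob_Int_nonneg)
qed

lemma exit_event_tendsto:
  assumes \<beta>: "\<beta> < \<alpha> - 2 * real CARD('d)"
  shows "(\<lambda>h. prob (exit_event (CARD('d) * h) (real h powr \<beta>))) \<longlonglongrightarrow> 0"
proof (rule tendstoI)
  fix \<kappa> :: real assume "0 < \<kappa>"
  then have \<kappa>: "0 < \<kappa> / 3" by simp
  define b where "b = max 0 \<beta>"
  \<comment> \<open>The midpoint between \<alpha> and \<open>2 * d + b\<close>, with d the
    dimension: below \<alpha>, yet large enough that \<open>2 * d + \<beta> - \<gamma>\<close> is
    negative.\<close>
  define \<gamma> where "\<gamma> = (\<alpha> + 2 * real CARD('d) + b) / 2"
  have b: "0 \<le> b" "b < \<alpha> - 2 * real CARD('d)" "\<beta> \<le> b" unfolding b_def using \<beta> \<alpha>_gt by auto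
  have \<gamma>: "real CARD('d) < \<gamma>" "\<gamma> < \<alpha>" using b \<alpha>_gt unfolding \<gamma>_def by auto
  have "real CARD('d) + \<beta> + (real CARD('d) - \<gamma>) < 0" using b unfolding \<gamma>_def by argo
  then have ex: "real CARD('d) + \<beta> + (1 - 0) * (real CARD('d) - \<gamma>) < 0" by simp
  note eventually_long_edge_le[OF \<gamma> ex \<kappa>]
  moreover have "eventually (\<lambda>h. \<forall>c. prob (fast_event c (CARD('d) * h) (real h powr \<beta>)) \<le> \<kappa> / 3) sequentially"
    using slow_at[OF \<beta>] \<kappa> unfolding slow_at_def eventually_sequentially by blast
  ultimately show "eventually (\<lambda>h. dist (prob (exit_event (CARD('d) * h) (real h powr \<beta>))) 0 < \<kappa>) sequentially"
  proof eventually_elim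
    case (elim h)
    have "prob (long_edge_event 0 (2 * (CARD('d) * h)) (CARD('d) * h) (real h powr \<beta>)) \<le> \<kappa> / 3"
      using elim(1) by auto
    then have "prob (exit_event (CARD('d) * h) (real h powr \<beta>)) \<le> \<kappa> / 3 + \<kappa> / 3"
      using prob_exit_le[of "CARD('d) * h" "real h powr \<beta>"] elim(2) by (meson add_mono order_trans)
    then show ?case using \<kappa> by (simp add: dist_real_def)
  qed
qed

section \<open>The upper bound\<close>

definition connect_event :: "int ^ 'd \<Rightarrow> real \<Rightarrow> 'a set" where
  "connect_event x t = {s\<in>space M. \<exists>p\<in>{p. lr_path p \<and> hd p = 0 \<and> last p = x}. path_weight r (wt s) p \<le> t}"

lemma sets_connect_event [measurable]: "connect_event x t \<in> events"
  unfolding connect_event_def by (rule sets_ex_path) auto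

lemma sets_no_bridge:
  assumes "finite A" "finite B"
  shows "{s\<in>space M. \<forall>u\<in>A. \<forall>v\<in>B. u \<noteq> v \<longrightarrow> \<tau> < lr_W r (wt s) u v} \<in> events"
proof -
  have "{s\<in>space M. \<forall>u\<in>A. \<forall>v\<in>B. u \<noteq> v \<longrightarrow> \<tau> < lr_W r (wt s) u v} =
    space M - (\<Union>u\<in>A. \<Union>v\<in>{v\<in>B. u \<noteq> v}. {s\<in>space M. lr_W r (wt s) u v \<le> \<tau>})"
    by (auto simp: not_le) (metis not_le)+
  also have "\<dots> \<in> events"
    using assms by (intro sets.Diff sets.top sets.finite_UN) (auto intro!: borel_measurable_le measurable_lr_W)
  finally show ?thesis .
qed

text \<open>The slack \<open>\<epsilon> = \<rho> - \<eta>\<close> is split as 1/2 + 1/3 + 1/6: edge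
  weights up to \<open>n powr (\<eta> + \<epsilon> / 2)\<close>, about
  \<open>n powr (\<epsilon> / 3)\<close> edges, and the factor 2. The rate bound loses
  \<open>\<epsilon> / 4\<close>, so a pair fails to be bridged with probability at most
  \<open>exp (- (c1 * n powr (\<epsilon> / 4)))\<close>, which beats the polynomial number of
  pairs.\<close>

lemma eventually_connect_ge:
  assumes \<rho>: "\<alpha> - 2 * real CARD('d) < \<rho>" and \<kappa>: "0 < \<kappa>"
  shows "eventually (\<lambda>n. \<forall>x. l1 x = n \<longrightarrow> 1 - \<kappa> \<le> prob (connect_event x (real n powr \<rho>))) sequentially"
proof -
  let ?d = "real CARD('d)"
  define \<eta> where "\<eta> = \<alpha> - 2 * ?d"
  define \<epsilon> where "\<epsilon> = \<rho> - \<eta>"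
  have \<epsilon>: "0 < \<epsilon>" and \<eta>: "0 < \<eta>" using \<rho> \<alpha>_gt unfolding \<epsilon>_def \<eta>_def by auto
  \<comment> \<open>Large enough for \<open>q powr (\<epsilon> / 3)\<close> to reach 2, and at least
    3 to keep the two balls of a bridge disjoint.\<close>
  define q where "q = max 3 (nat \<lceil>2 powr (3 / \<epsilon>)\<rceil>)"
  have q3: "3 \<le> q" unfolding q_def by simp
  have "2 powr (3 / \<epsilon>) \<le> real q" unfolding q_def by linarith
  then have "(2 powr (3 / \<epsilon>)) powr (\<epsilon> / 3) \<le> real q powr (\<epsilon> / 3)" using \<epsilon> by (intro powr_mono2) auto
  then have q2: "2 \<le> real q powr (\<epsilon> / 3)" using \<epsilon> by (simp add: powr_powr)
  have "\<alpha> < \<alpha> + \<epsilon> / 4" using \<epsilon> by simp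
  from prob_no_bridge_le[OF q3 this] obtain c where c0: "c > 0"
    and bound: "\<forall>a b \<tau>. a \<noteq> b \<longrightarrow> 0 \<le> \<tau> \<longrightarrow> prob {s\<in>space M. \<forall>u\<in>l1_ball a (l1 (a - b) div q). \<forall>v\<in>l1_ball b (l1 (a - b) div q).
        u \<noteq> v \<longrightarrow> \<tau> < lr_W r (wt s) u v}
      \<le> exp (- c * \<tau> * real (l1 (a - b)) powr (2 * ?d - (\<alpha> + \<epsilon> / 4)))"
    by (elim exE conjE)
  note c = c0 bound[rule_format]
  \<comment> \<open>Two points of the ball of radius \<open>2 * n\<close> are at distance at most
    \<open>4 * n\<close>, and the largest distance is the worst case.\<close>
  define c1 where "c1 = c * 4 powr (- (\<eta> + \<epsilon> / 4))"
  have c1: "0 < c1" unfolding c1_def using c by simp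
  have "((\<lambda>n. (5 * n) powr (2 * ?d) * exp (- (c1 * n powr (\<epsilon> / 4)))) \<longlongrightarrow> 0) at_top"
    using c1 \<epsilon> d_ge_1 by real_asymp
  then have "\<forall>\<^sub>F n in at_top. (5 * n) powr (2 * ?d) * exp (- (c1 * n powr (\<epsilon> / 4))) < \<kappa>"
    using \<kappa> by (intro order_tendstoD) auto
  note e1 = eventually_compose_filterlim[OF this filterlim_real_sequentially]
  have "\<forall>\<^sub>F n in at_top. 2 \<le> n powr (\<epsilon> / 6)" using \<epsilon> by real_asymp
  note e2 = eventually_compose_filterlim[OF this filterlim_real_sequentially]
  show ?thesis
    using e1 e2 eventually_ge_at_top[of 1]
  proof eventually_elim
    case (elim n)
    define \<tau> where "\<tau> = real n powr (\<eta> + \<epsilon> / 2)"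
    have \<tau>: "0 \<le> \<tau>" unfolding \<tau>_def by simp
    define N where "N a b = {s\<in>space M. \<forall>u\<in>l1_ball a (l1 (a - b) div q). \<forall>v\<in>l1_ball b (l1 (a - b) div q).
        u \<noteq> v \<longrightarrow> \<tau> < lr_W r (wt s) u v}" for a b :: "int ^ 'd"
    \<comment> \<open>Radius \<open>2 * n\<close> is the domain of the recursive construction
      between 0 and a point of norm \<open>n\<close>.\<close>
    define P where "P = {(a, b) \<in> l1_ball 0 (2 * n) \<times> l1_ball 0 (2 * n). a \<noteq> (b :: int ^ 'd)}"
    have finP: "finite P" unfolding P_def by (rule finite_subset[of _ "l1_ball 0 (2 * n) \<times> l1_ball 0 (2 * n)"]) auto
    have N_ev: "N a b \<in> events" for a b unfolding N_def by (rule sets_no_bridge) auto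
    have pN: "prob (N a b) \<le> exp (- (c1 * real n powr (\<epsilon> / 4)))" if "(a, b) \<in> P" for a b
    proof -
      have ab: "a \<noteq> b" "l1 a \<le> 2 * n" "l1 b \<le> 2 * n" using that unfolding P_def by (auto simp: mem_l1_ball)
      have m: "l1 (a - b) \<le> 4 * n" using ab l1_triangle_diff[of a b 0] l1_minus_commute[of 0 b] by simp
      have "real (4 * n) powr (- (\<eta> + \<epsilon> / 4)) \<le> real (l1 (a - b)) powr (- (\<eta> + \<epsilon> / 4))"
        using m ab(1) \<eta> \<epsilon> by (intro powr_mono2') (auto simp: of_nat_le_iff[symmetric] simp del: of_nat_le_iff)
      then have "c * \<tau> * real (4 * n) powr (- (\<eta> + \<epsilon> / 4)) \<le> c * \<tau> * real (l1 (a - b)) powr (- (\<eta> + \<epsilon> / 4))"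
        using c(1) \<tau> by (intro mult_left_mono) auto
      moreover have "c * \<tau> * real (4 * n) powr (- (\<eta> + \<epsilon> / 4)) = c1 * real n powr (\<epsilon> / 4)"
      proof -
        have "real n powr (\<eta> + \<epsilon> / 2) * real n powr (- (\<eta> + \<epsilon> / 4)) = real n powr (\<epsilon> / 4)"
          by (simp add: powr_add[symmetric])
        then show ?thesis unfolding c1_def \<tau>_def by (simp add: powr_mult mult_ac)
      qed
      moreover have "2 * ?d - (\<alpha> + \<epsilon> / 4) = - (\<eta> + \<epsilon> / 4)" unfolding \<eta>_def by simp
      ultimately have "c1 * real n powr (\<epsilon> / 4) \<le> c * \<tau> * real (l1 (a - b)) powr (2 * ?d - (\<alpha> + \<epsilon> / 4))"
        by (simp only:)
      then have "exp (- c * \<tau> * real (l1 (a - b)) powr (2 * ?d - (\<alpha> + \<epsilon> / 4))) \<le> exp (- (c1 * real n powr (\<epsilon> / 4)))"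
        by simp
      then show ?thesis using c(2)[OF ab(1) \<tau>] unfolding N_def by linarith
    qed
    have cP: "real (card P) \<le> (5 * real n) powr (2 * ?d)"
    proof -
      have "card P \<le> card (l1_ball (0 :: int ^ 'd) (2 * n) \<times> l1_ball (0 :: int ^ 'd) (2 * n))"
        unfolding P_def by (intro card_mono) auto
      also have "\<dots> \<le> (2 * (2 * n) + 1) ^ CARD('d) * (2 * (2 * n) + 1) ^ CARD('d)"
        unfolding card_cartesian_product by (intro mult_mono card_l1_ball_le) auto
      also have "\<dots> \<le> (5 * n) ^ CARD('d) * (5 * n) ^ CARD('d)"
        using elim by (intro mult_mono power_mono) auto
      finally have "real (card P) \<le> real ((5 * n) ^ CARD('d) * (5 * n) ^ CARD('d))" by (rule of_nat_mono)
      also have "\<dots> = (5 * real n) powr (2 * ?d)"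
      proof -
        have "(5 * real n) powr (2 * ?d) = (5 * real n) ^ (CARD('d) + CARD('d))"
          using powr_realpow[of "5 * real n" "CARD('d) + CARD('d)"] elim(3) by simp
        then show ?thesis by (simp only: power_add of_nat_mult of_nat_power of_nat_numeral)
      qed
      finally show ?thesis .
    qed
    show ?case
    proof (intro allI impI)
      fix x :: "int ^ 'd" assume x: "l1 x = n"
      have U_ev: "(\<Union>i\<in>P. case_prod N i) \<in> events" using finP N_ev by (intro sets.finite_UN) auto
      have "space M - (\<Union>i\<in>P. case_prod N i) \<subseteq> connect_event x (real n powr \<rho>)"
      proof
        fix s assume s: "s \<in> space M - (\<Union>i\<in>P. case_prod N i)"
        have bridge: "\<exists>u\<in>l1_ball a (l1 (a - b) div q). \<exists>v\<in>l1_ball b (l1 (a - b) div q). u \<noteq> v \<and> lr_W r (wt s) u v \<le> \<tau>"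
          if "a \<noteq> b" "l1 a \<le> 2 * n" "l1 b \<le> 2 * n" for a b :: "int ^ 'd"
        proof -
          have "(a, b) \<in> P" using that unfolding P_def by (auto simp: mem_l1_ball)
          then have "s \<notin> N a b" using s by auto
          then show ?thesis using s unfolding N_def by (auto simp: not_less)
        qed
        have dom: "max (l1 (0 :: int ^ 'd)) (l1 x) + l1 (0 - x) \<le> 2 * n"
          using x l1_minus_commute[of 0 x] by simp
        have "0 < \<epsilon> / 3" using \<epsilon> by simp
        from ex_hierarchical_path[OF q3 q2 this \<tau> bridge dom] obtain p where p: "lr_path p" "hd p = 0" "last p = x"
          "path_weight r (wt s) p \<le> (if 0 = x then 0 else 2 * real (l1 (0 - x)) powr (\<epsilon> / 3) - 1) * \<tau>"
          by blast
        have "path_weight r (wt s) p \<le> (2 * real n powr (\<epsilon> / 3)) * \<tau>"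
          using p(4) x l1_minus_commute[of 0 x] elim(3) \<tau>
          by (auto simp: algebra_simps split: if_splits)
        also have "\<dots> \<le> (real n powr (\<epsilon> / 6) * real n powr (\<epsilon> / 3)) * \<tau>"
          using elim(2) \<tau> by (intro mult_right_mono) auto
        also have "\<dots> = real n powr \<rho>"
          unfolding \<tau>_def \<epsilon>_def by (simp add: powr_add[symmetric] field_simps)
        finally show "s \<in> connect_event x (real n powr \<rho>)" using s p unfolding connect_event_def by auto
      qed
      then have "prob (space M - (\<Union>i\<in>P. case_prod N i)) \<le> prob (connect_event x (real n powr \<rho>))"
        by (intro finite_measure_mono) auto
      moreover have "prob (\<Union>i\<in>P. case_prod N i) \<le> \<kappa>"
      proof -
        have "prob (\<Union>i\<in>P. case_prod N i) \<le> (\<Sum>i\<in>P. prob (case_prod N i))"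
          using finP N_ev by (intro finite_measure_subadditive_finite) auto
        also have "\<dots> \<le> (\<Sum>i\<in>P. exp (- (c1 * real n powr (\<epsilon> / 4))))"
          using pN by (intro sum_mono) auto
        also have "\<dots> = real (card P) * exp (- (c1 * real n powr (\<epsilon> / 4)))" by simp
        also have "\<dots> \<le> (5 * real n) powr (2 * ?d) * exp (- (c1 * real n powr (\<epsilon> / 4)))"
          by (intro mult_right_mono cP) simp
        finally show ?thesis using elim(1) by linarith
      qed
      ultimately show "1 - \<kappa> \<le> prob (connect_event x (real n powr \<rho>))"
        using prob_compl[OF U_ev] by linarith
    qed
  qed
qed

section \<open>Passage times and the diameter of balls\<close>

lemma measurable_passage_time [measurable]:
  "(\<lambda>s. passage_time r (wt s) x y) \<in> borel_measurable M"
  unfolding passage_time_def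
  by (intro borel_measurable_INF borel_measurable_ereal measurable_path_weight)
    (auto intro: countable_subset[OF subset_UNIV])

lemma measurable_diam_T [measurable]:
  "(\<lambda>s. diam_T r (wt s) t) \<in> borel_measurable M"
proof (rule borel_measurableI_greater)
  fix a :: ereal
  have "{s\<in>space M. a < diam_T r (wt s) t} = (\<Union>(x, y)\<in>{(x, y). a < ereal (real (l1 (x - y)))}.
      {s\<in>space M. passage_time r (wt s) 0 x \<le> ereal t \<and> passage_time r (wt s) 0 y \<le> ereal t})"
    unfolding diam_T_def less_SUP_iff ball_T_def by auto
  also have "\<dots> \<in> events"
    by (intro sets.countable_UN'') (auto intro: countable_subset[OF subset_UNIV])
  finally show "{s\<in>space M. a < diam_T r (wt s) t} \<in> events" .
qed

lemma passage_time_le_if_connect: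
  "s \<in> connect_event x t \<Longrightarrow> passage_time r (wt s) 0 x \<le> ereal t"
  unfolding connect_event_def passage_time_def by (auto intro!: INF_lower2)

lemma passage_time_ge_if_not_exit:
  assumes "s \<in> space M" "s \<notin> exit_event n t" "x \<notin> l1_ball 0 (2 * n)"
  shows "ereal t \<le> passage_time r (wt s) 0 x"
  unfolding passage_time_def
proof (rule INF_greatest)
  fix p assume "p \<in> {p. lr_path p \<and> hd p = 0 \<and> last p = x}"
  then have "\<not> path_weight r (wt s) p \<le> t" using assms unfolding exit_event_def by auto
  then show "ereal t \<le> ereal (path_weight r (wt s) p)" by simp
qed

lemma prob_Diff_ge: "A \<in> events \<Longrightarrow> B \<in> events \<Longrightarrow> prob A - prob B \<le> prob (A - B)"
  using finite_measure_Diff'[of A B] finite_measure_mono[of "A \<inter> B" B] by simp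

text \<open>On the connection event minus the exit event the passage time lies between the powers
  \<open>\<eta> - \<epsilon>\<close> and \<open>\<eta> + \<epsilon>\<close> of the distance. The
  same bounds make it positive and finite, so \<open>real_of_ereal\<close> and \<open>ln\<close>
  return no default values.\<close>

lemma passage_time_exponent:
  assumes \<epsilon>: "0 < \<epsilon>"
  shows "((\<lambda>x. prob {s \<in> space M.
             0 < passage_time r (wt s) 0 x \<and> passage_time r (wt s) 0 x < \<infinity> \<and>
             (\<alpha> - 2 * real CARD('d)) - \<epsilon>
               \<le> ln (real_of_ereal (passage_time r (wt s) 0 x)) / ln (real (l1 x)) \<and>
             ln (real_of_ereal (passage_time r (wt s) 0 x)) / ln (real (l1 x))
               \<le> (\<alpha> - 2 * real CARD('d)) + \<epsilon>})
          \<longlongrightarrow> 1) (filtercomap l1 at_top)"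
proof (rule tendstoI)
  fix \<kappa> :: real assume \<kappa>: "0 < \<kappa>"
  let ?d = "real CARD('d)"
  define \<eta> where "\<eta> = \<alpha> - 2 * ?d"
  have \<eta>: "0 < \<eta>" using \<alpha>_gt unfolding \<eta>_def by auto
  \<comment> \<open>Strictly between \<open>\<eta> - \<epsilon>\<close> and \<open>\<eta>\<close>:
    the gap \<open>g\<close> absorbs the constant factor between \<open>n\<close> and
    \<open>h\<close>.\<close>
  define \<beta> where "\<beta> = \<eta> - min \<epsilon> \<eta> / 2"
  have \<beta>: "0 < \<beta>" "\<beta> < \<eta>" "\<eta> - \<epsilon> < \<beta>" using \<eta> \<epsilon> unfolding \<beta>_def by auto
  let ?S = "\<lambda>x. {s \<in> space M.
     0 < passage_time r (wt s) 0 x \<and> passage_time r (wt s) 0 x < \<infinity> \<and>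
     \<eta> - \<epsilon> \<le> ln (real_of_ereal (passage_time r (wt s) 0 x)) / ln (real (l1 x)) \<and>
     ln (real_of_ereal (passage_time r (wt s) 0 x)) / ln (real (l1 x)) \<le> \<eta> + \<epsilon>}"
  have S_ev: "?S x \<in> events" for x by measurable
  have \<kappa>3: "0 < \<kappa> / 3" using \<kappa> by simp
  have "\<alpha> - 2 * ?d < \<eta> + \<epsilon>" using \<epsilon> unfolding \<eta>_def by simp
  note e1 = eventually_connect_ge[OF this \<kappa>3]
  have "(\<lambda>h. prob (exit_event (CARD('d) * h) (real h powr \<beta>))) \<longlonglongrightarrow> 0"
    using \<beta>(2) unfolding \<eta>_def by (rule exit_event_tendsto)
  then have "eventually (\<lambda>h. prob (exit_event (CARD('d) * h) (real h powr \<beta>)) < \<kappa> / 3) sequentially"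
    using \<kappa>3 by (rule order_tendstoD)
  then obtain h0 where h0: "\<And>h. h0 \<le> h \<Longrightarrow> prob (exit_event (CARD('d) * h) (real h powr \<beta>)) < \<kappa> / 3"
    unfolding eventually_sequentially by blast
  define g where "g = \<beta> - (\<eta> - \<epsilon>)"
  have "0 < g" using \<beta> unfolding g_def by simp
  then have "\<forall>\<^sub>F n in at_top. (4 * ?d) powr \<beta> \<le> n powr g" by real_asymp
  note e2 = eventually_compose_filterlim[OF this filterlim_real_sequentially]
  have "eventually (\<lambda>n. \<forall>x. l1 x = n \<longrightarrow> 1 - \<kappa> < prob (?S x)) sequentially"
    using e1 e2 eventually_ge_at_top[of "4 * CARD('d) * (h0 + 1)"]
  proof eventually_elim
    case (elim n)
    \<comment> \<open>Subtracting 1 puts a point of norm \<open>n\<close> strictly outside the ball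
      of radius \<open>2 * CARD('d) * h\<close>.\<close>
    define h where "h = (n - 1) div (2 * CARD('d))"
    have "4 * CARD('d) * 1 \<le> 4 * CARD('d) * (h0 + 1)" by (intro mult_left_mono) auto
    then have n4: "4 * CARD('d) \<le> n" using elim(3) by simp
    then have n2: "2 \<le> n" using d_ge_1 by linarith
    have hn: "2 * CARD('d) * h \<le> n - 1" unfolding h_def by simp
    have "n - 1 < 2 * CARD('d) * (h + 1)"
      unfolding h_def using d_ge_1 dividend_less_times_div[of "2 * CARD('d)" "n - 1"] by simp
    then have "n \<le> 2 * CARD('d) * h + 2 * CARD('d)" by simp
    then have nh: "n \<le> 4 * CARD('d) * h" using n4 by simp
    have "4 * CARD('d) * (h0 + 1) \<le> 4 * CARD('d) * h" using nh elim(3) by linarith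
    then have hh0: "h0 + 1 \<le> h" by (rule mult_left_le_imp_le) simp
    have "real n \<le> real (4 * CARD('d) * h)" using nh by (rule of_nat_mono)
    then have "real n powr \<beta> \<le> (4 * ?d * real h) powr \<beta>" using \<beta> by (intro powr_mono2) auto
    also have "\<dots> = (4 * ?d) powr \<beta> * real h powr \<beta>" by (simp add: powr_mult)
    also have "\<dots> \<le> real n powr g * real h powr \<beta>" using elim(2) by (intro mult_right_mono) auto
    finally have "real n powr (\<eta> - \<epsilon>) * real n powr g \<le> real h powr \<beta> * real n powr g"
      unfolding powr_add[symmetric] g_def by (simp add: mult.commute)
    then have lower: "real n powr (\<eta> - \<epsilon>) \<le> real h powr \<beta>" using n2 by simp
    show ?case
    proof (intro allI impI)
      fix x :: "int ^ 'd" assume x: "l1 x = n"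
      let ?G = "connect_event x (real n powr (\<eta> + \<epsilon>)) - exit_event (CARD('d) * h) (real h powr \<beta>)"
      have "?G \<subseteq> ?S x"
      proof
        fix s assume s: "s \<in> ?G"
        let ?T = "passage_time r (wt s) 0 x"
        have sM: "s \<in> space M" using s unfolding connect_event_def by auto
        have up: "?T \<le> ereal (real n powr (\<eta> + \<epsilon>))" using s by (intro passage_time_le_if_connect) auto
        have "x \<notin> l1_ball 0 (2 * (CARD('d) * h))" using x hn n2 by (simp add: mem_l1_ball)
        then have "ereal (real h powr \<beta>) \<le> ?T" using s sM by (intro passage_time_ge_if_not_exit) auto
        then have lo: "ereal (real n powr (\<eta> - \<epsilon>)) \<le> ?T" using lower by (meson ereal_less_eq(3) order_trans)
        obtain T where T: "?T = ereal T" using up lo by (cases ?T) auto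
        have T': "real n powr (\<eta> - \<epsilon>) \<le> T" "T \<le> real n powr (\<eta> + \<epsilon>)" using up lo unfolding T by auto
        have "0 < real n powr (\<eta> - \<epsilon>)" using n2 by simp
        then have T0: "0 < T" using T'(1) by linarith
        have ln: "0 < ln (real n)" using n2 by simp
        have "(\<eta> - \<epsilon>) * ln (real n) \<le> ln T"
          using ln_mono[OF T'(1) \<open>0 < real n powr (\<eta> - \<epsilon>)\<close>] n2 by (simp add: ln_powr)
        moreover have "ln T \<le> (\<eta> + \<epsilon>) * ln (real n)"
          using ln_mono[OF T'(2) T0] n2 by (simp add: ln_powr)
        ultimately have "\<eta> - \<epsilon> \<le> ln T / ln (real n)" "ln T / ln (real n) \<le> \<eta> + \<epsilon>"
          using ln by (simp_all add: field_simps)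
        then show "s \<in> ?S x" using sM T0 by (simp add: T x)
      qed
      then have "prob ?G \<le> prob (?S x)" using S_ev by (intro finite_measure_mono) auto
      moreover have "1 - \<kappa> / 3 \<le> prob (connect_event x (real n powr (\<eta> + \<epsilon>)))" using elim(1) x by blast
      moreover have "prob (exit_event (CARD('d) * h) (real h powr \<beta>)) < \<kappa> / 3" using hh0 by (intro h0) simp
      ultimately show "1 - \<kappa> < prob (?S x)"
        using prob_Diff_ge[of "connect_event x (real n powr (\<eta> + \<epsilon>))" "exit_event (CARD('d) * h) (real h powr \<beta>)"] \<kappa>
        by simp
    qed
  qed
  then have "eventually (\<lambda>x. 1 - \<kappa> < prob (?S x)) (filtercomap l1 at_top)"
    unfolding eventually_sequentially eventually_filtercomap_at_top_linorder by blast
  then show "eventually (\<lambda>x. dist (prob {s \<in> space M.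
             0 < passage_time r (wt s) 0 x \<and> passage_time r (wt s) 0 x < \<infinity> \<and>
             (\<alpha> - 2 * real CARD('d)) - \<epsilon>
               \<le> ln (real_of_ereal (passage_time r (wt s) 0 x)) / ln (real (l1 x)) \<and>
             ln (real_of_ereal (passage_time r (wt s) 0 x)) / ln (real (l1 x))
               \<le> (\<alpha> - 2 * real CARD('d)) + \<epsilon>}) 1 < \<kappa>) (filtercomap l1 at_top)"
  proof eventually_elim
    case (elim x)
    then show ?case using prob_le_1[of "?S x"] unfolding \<eta>_def dist_real_def by linarith
  qed
qed

text \<open>Inverts the relation between time and distance. Since \<open>1 / a > \<eta>\<close>, a
  point at distance about \<open>t powr a\<close> is reached by time \<open>t\<close>; since
  \<open>1 / b < \<eta>\<close>, a ball of radius of order \<open>t powr b\<close> is not left by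
  then.\<close>

lemma diam_T_exponent:
  assumes \<epsilon>: "0 < \<epsilon>"
  shows "((\<lambda>t. prob {s \<in> space M.
             0 < diam_T r (wt s) t \<and> diam_T r (wt s) t < \<infinity> \<and>
             \<bar>ln (real_of_ereal (diam_T r (wt s) t)) / ln t
                - 1 / (\<alpha> - 2 * real CARD('d))\<bar> \<le> \<epsilon>})
          \<longlongrightarrow> 1) at_top"
proof (rule tendstoI)
  fix \<kappa> :: real assume \<kappa>: "0 < \<kappa>"
  let ?d = "real CARD('d)"
  define \<eta> where "\<eta> = \<alpha> - 2 * ?d"
  have \<eta>: "0 < \<eta>" using \<alpha>_gt unfolding \<eta>_def by auto
  define b where "b = 1 / \<eta> + \<epsilon> / 2"
  \<comment> \<open>The maximum with \<open>1 / (2 * \<eta>)\<close> keeps \<open>a\<close> positive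
    for large \<epsilon>.\<close>
  define a where "a = max (1 / \<eta> - \<epsilon> / 2) (1 / (2 * \<eta>))"
  have b: "0 < b" "1 / \<eta> < b" unfolding b_def using \<eta> \<epsilon> by (auto intro: add_pos_pos)
  have a: "0 < a" "a < 1 / \<eta>" "1 / \<eta> - \<epsilon> / 2 \<le> a"
    unfolding a_def using \<eta> \<epsilon> by (auto simp: field_simps less_max_iff_disj)
  have b': "1 / b < \<alpha> - 2 * ?d" and a': "\<alpha> - 2 * ?d < 1 / a"
    using a b \<eta> unfolding \<eta>_def[symmetric] by (auto simp: field_simps)
  let ?S = "\<lambda>t. {s \<in> space M. 0 < diam_T r (wt s) t \<and> diam_T r (wt s) t < \<infinity> \<and>
     \<bar>ln (real_of_ereal (diam_T r (wt s) t)) / ln t - 1 / \<eta>\<bar> \<le> \<epsilon>}"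
  have S_ev: "?S t \<in> events" for t by measurable
  have \<kappa>3: "0 < \<kappa> / 3" using \<kappa> by simp
  have "filterlim (\<lambda>t :: real. nat \<lfloor>t powr a\<rfloor>) sequentially at_top"
    using a(1) by (intro filterlim_compose[OF filterlim_nat_sequentially]
        filterlim_compose[OF filterlim_floor_sequentially]) real_asymp
  note e1 = eventually_compose_filterlim[OF eventually_connect_ge[OF a' \<kappa>3] this]
  have "eventually (\<lambda>h. prob (exit_event (CARD('d) * h) (real h powr (1 / b))) < \<kappa> / 3) sequentially"
    using exit_event_tendsto[OF b'] \<kappa>3 by (rule order_tendstoD)
  moreover have "filterlim (\<lambda>t :: real. nat \<lceil>t powr b\<rceil> + 1) sequentially at_top"
  proof -
    have "filterlim (\<lambda>t :: real. real (nat \<lceil>t powr b\<rceil> + 1)) at_top at_top"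
    proof (rule filterlim_at_top_mono)
      show "filterlim (\<lambda>t :: real. t powr b) at_top at_top" using b(1) by real_asymp
    qed (auto intro!: always_eventually, linarith)
    then show ?thesis by (simp add: filterlim_sequentially_iff_filterlim_real)
  qed
  ultimately have e2: "eventually (\<lambda>t. prob (exit_event (CARD('d) * (nat \<lceil>t powr b\<rceil> + 1))
      (real (nat \<lceil>t powr b\<rceil> + 1) powr (1 / b))) < \<kappa> / 3) at_top"
    by (rule eventually_compose_filterlim)
  have e3: "\<forall>\<^sub>F t in at_top. ln (12 * ?d) \<le> \<epsilon> / 2 * ln t" using \<epsilon> by real_asymp
  have e4: "\<forall>\<^sub>F t in at_top. ln 2 \<le> \<epsilon> / 2 * ln t" using \<epsilon> by real_asymp
  have e5: "\<forall>\<^sub>F t in at_top. 2 \<le> t powr a" using a(1) by real_asymp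
  have "eventually (\<lambda>t. 1 - \<kappa> < prob (?S t)) at_top"
    using e1 e2 e3 e4 e5 eventually_gt_at_top[of 1]
  proof eventually_elim
    case (elim t)
    have t: "1 < t" by (rule elim)
    define n where "n = nat \<lfloor>t powr a\<rfloor>"
    \<comment> \<open>The added 1 makes \<open>h powr (1 / b)\<close> strictly larger than
      \<open>t\<close>; non-exit gives only a non-strict lower bound on the passage time.\<close>
    define h where "h = nat \<lceil>t powr b\<rceil> + 1"
    obtain x :: "int ^ 'd" where x: "l1 x = n" using ex_l1_eq by blast
    have n_up: "real n \<le> t powr a" unfolding n_def by (rule of_nat_floor) simp
    have n_lo: "t powr a / 2 \<le> real n" using elim(5) unfolding n_def by linarith
    have npos: "0 < real n" using n_lo elim(5) by linarith
    have "real n powr (1 / a) \<le> (t powr a) powr (1 / a)" using n_up a(1) by (intro powr_mono2) auto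
    then have nt: "real n powr (1 / a) \<le> t" using a(1) t by (simp add: powr_powr)
    have "t powr b < real h" unfolding h_def by linarith
    then have "(t powr b) powr (1 / b) < real h powr (1 / b)" using b(1) by (intro powr_less_mono2) auto
    then have th: "t < real h powr (1 / b)" using b(1) t by (simp add: powr_powr)
    have "1 \<le> t powr b" using t b(1) by (intro ge_one_powr_ge_zero) auto
    then have h_up: "real h \<le> 3 * t powr b" unfolding h_def by linarith
    let ?G = "connect_event x (real n powr (1 / a)) - exit_event (CARD('d) * h) (real h powr (1 / b))"
    have "?G \<subseteq> ?S t"
    proof
      fix s assume s: "s \<in> ?G"
      let ?D = "diam_T r (wt s) t"
      have sM: "s \<in> space M" using s unfolding connect_event_def by auto
      have "passage_time r (wt s) 0 x \<le> ereal (real n powr (1 / a))"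
        using s by (intro passage_time_le_if_connect) auto
      then have xB: "x \<in> ball_T r (wt s) t" using nt unfolding ball_T_def by (auto intro: order_trans)
      have "passage_time r (wt s) 0 0 \<le> ereal 0"
        unfolding passage_time_def by (rule INF_lower2[of "[0]"]) auto
      then have 0: "0 \<in> ball_T r (wt s) t" using t unfolding ball_T_def by (auto intro: order_trans)
      have "ereal (real (l1 (x - 0))) \<le> ?D"
        unfolding diam_T_def using xB 0 by (intro SUP_upper2[of "(x, 0)"]) auto
      then have lo: "ereal (real n) \<le> ?D" using x by simp
      have ball: "l1 y \<le> 2 * (CARD('d) * h)" if "y \<in> ball_T r (wt s) t" for y
      proof (rule ccontr)
        assume "\<not> l1 y \<le> 2 * (CARD('d) * h)"
        then have "y \<notin> l1_ball 0 (2 * (CARD('d) * h))" by (simp add: mem_l1_ball)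
        then have "ereal (real h powr (1 / b)) \<le> passage_time r (wt s) 0 y"
          using s sM by (intro passage_time_ge_if_not_exit) auto
        also have "\<dots> \<le> ereal t" using that unfolding ball_T_def by simp
        finally show False using th by simp
      qed
      \<comment> \<open>Two points of norm at most \<open>2 * CARD('d) * h\<close>, with
        \<open>h\<close> at most \<open>3 * t powr b\<close>, give the 12.\<close>
      have up: "?D \<le> ereal (12 * ?d * t powr b)"
        unfolding diam_T_def
      proof (rule SUP_least, clarify)
        fix y z assume yz: "y \<in> ball_T r (wt s) t" "z \<in> ball_T r (wt s) t"
        have "l1 (y - z) \<le> l1 y + l1 z"
          using l1_triangle_diff[of y z 0] l1_minus_commute[of 0 z] by simp
        also have "\<dots> \<le> 4 * CARD('d) * h" using ball[OF yz(1)] ball[OF yz(2)] by simp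
        finally have "real (l1 (y - z)) \<le> real (4 * CARD('d) * h)" by (rule of_nat_mono)
        also have "\<dots> = 4 * ?d * real h" by simp
        also have "\<dots> \<le> 4 * ?d * (3 * t powr b)" using h_up by (intro mult_left_mono) auto
        finally show "ereal (real (l1 (y - z))) \<le> ereal (12 * ?d * t powr b)" by (simp add: mult_ac)
      qed
      obtain D where D: "?D = ereal D" using up lo by (cases ?D) auto
      have D': "real n \<le> D" "D \<le> 12 * ?d * t powr b" using up lo unfolding D by auto
      have D0: "0 < D" using D'(1) npos by linarith
      have ln: "0 < ln t" using t by simp
      have "ln D \<le> ln (12 * ?d * t powr b)" using D' D0 by (intro ln_mono) auto
      also have "\<dots> = ln (12 * ?d) + b * ln t" using t d_ge_1 by (simp add: ln_mult ln_powr)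
      finally have 1: "ln D \<le> (1 / \<eta> + \<epsilon>) * ln t" using elim(3) unfolding b_def by (simp add: algebra_simps)
      have "a * ln t - ln 2 = ln (t powr a / 2)" using t by (simp add: ln_div ln_powr)
      also have "\<dots> \<le> ln D" using D' n_lo D0 t by (intro ln_mono) auto
      finally have "a * ln t - ln 2 \<le> ln D" .
      moreover have "(1 / \<eta> - \<epsilon> / 2) * ln t \<le> a * ln t" using a(3) ln by (intro mult_right_mono) auto
      ultimately have 2: "(1 / \<eta> - \<epsilon>) * ln t \<le> ln D" using elim(4) by (simp add: algebra_simps)
      have "ln D / ln t \<le> 1 / \<eta> + \<epsilon>" using 1 ln by (simp add: pos_divide_le_eq)
      moreover have "1 / \<eta> - \<epsilon> \<le> ln D / ln t" using 2 ln by (simp add: pos_le_divide_eq)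
      ultimately have "\<bar>ln D / ln t - 1 / \<eta>\<bar> \<le> \<epsilon>" by linarith
      then show "s \<in> ?S t" using sM D0 by (simp add: D)
    qed
    then have "prob ?G \<le> prob (?S t)" using S_ev by (intro finite_measure_mono) auto
    moreover have "1 - \<kappa> / 3 \<le> prob (connect_event x (real n powr (1 / a)))"
      using elim(1) x unfolding n_def by blast
    moreover have "prob (exit_event (CARD('d) * h) (real h powr (1 / b))) < \<kappa> / 3"
      using elim(2) unfolding h_def .
    ultimately show "1 - \<kappa> < prob (?S t)"
      using prob_Diff_ge[of "connect_event x (real n powr (1 / a))" "exit_event (CARD('d) * h) (real h powr (1 / b))"] \<kappa>
      by simp
  qed
  then show "eventually (\<lambda>t. dist (prob {s \<in> space M.
             0 < diam_T r (wt s) t \<and> diam_T r (wt s) t < \<infinity> \<and>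
             \<bar>ln (real_of_ereal (diam_T r (wt s) t)) / ln t
                - 1 / (\<alpha> - 2 * real CARD('d))\<bar> \<le> \<epsilon>}) 1 < \<kappa>) at_top"
  proof eventually_elim
    case (elim t)
    then show ?case using prob_le_1[of "?S t"] unfolding \<eta>_def dist_real_def by linarith
  qed
qed

end

theorem theorem1p5:
  fixes M :: "'a measure"
    and \<omega> :: "(int ^ 'd::finite) set \<Rightarrow> 'a \<Rightarrow> real"
    and r :: "nat \<Rightarrow> real" and L :: "real \<Rightarrow> real" and \<alpha> :: real
  assumes "prob_space M"
    and "prob_space.indep_vars M (\<lambda>_. borel) \<omega> lr_edges"
    and "\<And>e. e \<in> lr_edges \<Longrightarrow> distributed M lborel (\<omega> e) (exponential_density 1)"
    and "slowly_varying L" and "L 1 = 1"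
    and "\<And>k. 1 \<le> k \<Longrightarrow> r k = real k powr (- \<alpha>) * L (real k)"
    and "\<And>k. 1 \<le> k \<Longrightarrow> 0 \<le> r k"
    and "\<And>k m. 1 \<le> k \<Longrightarrow> k \<le> m \<Longrightarrow> r m \<le> r k"
    and "2 * real CARD('d) < \<alpha>" and "\<alpha> < 2 * real CARD('d) + 1"
    and "0 < \<epsilon>"
  shows "((\<lambda>x. measure M {s \<in> space M.
             0 < passage_time r (\<lambda>e. \<omega> e s) 0 x \<and> passage_time r (\<lambda>e. \<omega> e s) 0 x < \<infinity> \<and>
             (\<alpha> - 2 * real CARD('d)) - \<epsilon>
               \<le> ln (real_of_ereal (passage_time r (\<lambda>e. \<omega> e s) 0 x)) / ln (real (l1 x)) \<and>
             ln (real_of_ereal (passage_time r (\<lambda>e. \<omega> e s) 0 x)) / ln (real (l1 x))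
               \<le> (\<alpha> - 2 * real CARD('d)) + \<epsilon>})
          \<longlongrightarrow> 1) (filtercomap l1 at_top)
       \<and> ((\<lambda>t. measure M {s \<in> space M.
             0 < diam_T r (\<lambda>e. \<omega> e s) t \<and> diam_T r (\<lambda>e. \<omega> e s) t < \<infinity> \<and>
             \<bar>ln (real_of_ereal (diam_T r (\<lambda>e. \<omega> e s) t)) / ln t
                - 1 / (\<alpha> - 2 * real CARD('d))\<bar> \<le> \<epsilon>})
          \<longlongrightarrow> 1) at_top"
proof -
  have pos: "0 < r k" if "1 \<le> k" for k
    using assms(4) that unfolding assms(6)[OF that] slowly_varying_def by simp
  have lim: "(\<lambda>k. r (2 * k) / r k) \<longlonglongrightarrow> 2 powr (- \<alpha>)"
    using assms(4,6) by (rule slowly_varying_doubling)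
  \<comment> \<open>An exponent other than \<alpha> puts its power of 2 strictly on one side of the
    limit of \<open>r (2 * k) / r k\<close>, so the doubling inequality holds eventually;
    \<open>lower\<close> is symmetric.\<close>
  have upper: "\<exists>C>0. \<forall>k\<ge>1. r k \<le> C * real k powr (- \<gamma>)" if \<gamma>: "0 < \<gamma>" "\<gamma> < \<alpha>" for \<gamma>
  proof (rule doubling_upper_bound[OF pos assms(8) _ \<gamma>(1)])
    have "2 powr (- \<alpha>) < 2 powr (- \<gamma>)" using \<gamma> by (intro powr_less_mono) auto
    with lim have "\<forall>\<^sub>F k in sequentially. r (2 * k) / r k < 2 powr (- \<gamma>)" by (rule order_tendstoD)
    then show "\<forall>\<^sub>F k in sequentially. r (2 * k) \<le> 2 powr (- \<gamma>) * r k"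
      using eventually_ge_at_top[of 1]
    proof eventually_elim
      case (elim k) then show ?case using pos[of k] by (simp add: pos_divide_less_eq)
    qed
  qed auto
  have lower: "\<exists>c>0. \<forall>k\<ge>1. c * real k powr (- \<gamma>) \<le> r k" if \<gamma>: "\<alpha> < \<gamma>" for \<gamma>
  proof (rule doubling_lower_bound[OF pos assms(8)])
    have "2 powr (- \<gamma>) < 2 powr (- \<alpha>)" using \<gamma> by (intro powr_less_mono) auto
    with lim have "\<forall>\<^sub>F k in sequentially. 2 powr (- \<gamma>) < r (2 * k) / r k" by (rule order_tendstoD)
    then show "\<forall>\<^sub>F k in sequentially. 2 powr (- \<gamma>) * r k \<le> r (2 * k)"
      using eventually_ge_at_top[of 1]
    proof eventually_elim
      case (elim k) then show ?case using pos[of k] by (simp add: pos_less_divide_eq)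
    qed
    have "0 \<le> 2 * real CARD('d)" by simp
    then show "0 < \<gamma>" using \<gamma> assms(9) by linarith
  qed auto
  interpret lr_fpp M \<omega> r \<alpha>
    using assms pos upper lower by (simp add: lr_fpp_def lr_fpp_axioms_def)
  show ?thesis
    using passage_time_exponent[OF assms(11)] diam_T_exponent[OF assms(11)] by (rule conjI)
qed

end
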